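(* Let $X$ be an infinite ultrahomogeneous discrete chain and $G=(\mathrm{Aut}(X),\tau_\partial)$. Then: (a) $e_{b_mX}G$ is the completion of $(G,R_{\Sigma_{b_mX}})$; (b) $G$ is Roelcke precompact, $b_rG\leq e_{b_mX}G$, and $\mathfrak E(b_rG)=e_{b_mX}G$; (c) $e_{b_mX}G$ is the set of maps $f:b_mX\to b_mX$, with the topology of pointwise convergence, such that (i) $f$ is non-decreasing; (ii) $f(x)\notin X$ whenever $x\in b_mX\setminus X$; (iii) if $f(x)=f(y)$ with $x\neq y$ then $f(x)\in b_mX\setminus X$; (iv) for every $x\in X$ either $f((x,-1))=f((x,0))=f((x,1))\notin X$, or there is $y\in X$ with $f((x,j))=(y,j)$ for $j=-1,0,1$; (v) $f(\inf)=\inf$, $f(\sup)=\sup$; (d) $b_rG$ is the set of maps $f:X\to b_mX$, with the topology of pointwise convergence, which are non-decreasing and such that $f(x)=f(y)$ with $x\neq y$ implies $f(x)\in b_mX\setminus X$. If $X$ is continuously ordered, then $b_rG=e_{b_mX}G$.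
   Context: Ultrahomogeneous chain: for all $x_1<\dots<x_n$, $y_1<\dots<y_n$ there is an order automorphism with $g(x_k)=y_k$. $\tau_\partial$: topology of pointwise convergence for discrete $X$. $b_mX$: $X\times\{-1,0,1\}$ (lexicographic order) plus one point for each gap of $X$ (cut $(A,B)$, $A<B$, $A$ without max, $B$ without min, including $\inf$ ($A=\emptyset$) and $\sup$ ($B=\emptyset$)), with order topology, $X\equiv X\times\{0\}$; $G$ acts by $g(x,j)=(gx,j)$, $g(A,B)=(gA,gB)$. $e_KG$ is the closure of $\iota_K(G)$, $\iota_K(g)(x)=gx$, in $K^K$. For a $G$-set $Z$, $\mathrm{St}_\sigma$ is the pointwise stabilizer of a finite $\sigma\subset Z$ and $R_{\Sigma_Z}$ is the uniformity on $G$ with base covers $\{Og\,\mathrm{St}_\sigma:g\in G\}$. Roelcke precompact: the uniformity with base covers $\{OgO\}$ is totally bounded; $b_rG$ is the completion in it. For a $G$-compactification $bG$ of $G$ (left action), $\mathfrak E(bG)=e_{bG}G$. Continuously ordered: densely ordered without proper gaps. *)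

theory Defs
  imports "HOL-Analysis.Analysis"
begin

definition aut :: "('a::linorder \<Rightarrow> 'a) set" where
  "aut = {g. bij g \<and> strict_mono g}"

definition ultrahomogeneous :: "'a::linorder itself \<Rightarrow> bool" where
  "ultrahomogeneous _ \<longleftrightarrow>
     (\<forall>xs ys :: 'a list. sorted_wrt (<) xs \<and> sorted_wrt (<) ys \<and> length xs = length ys \<longrightarrow>
        (\<exists>g\<in>aut. \<forall>k<length xs. g (xs ! k) = ys ! k))"

text \<open>Gap of X, represented by its lower part A (B = - A): A downward closed,
  A without maximum, B without minimum.\<close>
definition is_gap :: "'a::linorder set \<Rightarrow> bool" where
  "is_gap A \<longleftrightarrow> (\<forall>x y. x \<in> A \<longrightarrow> y \<le> x \<longrightarrow> y \<in> A)
      \<and> (\<forall>x\<in>A. \<exists>x'\<in>A. x < x') \<and> (\<forall>y\<in>-A. \<exists>y'\<in>-A. y' < y)"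

definition continuously_ordered :: "'a::linorder itself \<Rightarrow> bool" where
  "continuously_ordered _ \<longleftrightarrow> (\<forall>x y :: 'a. x < y \<longrightarrow> (\<exists>z. x < z \<and> z < y))
      \<and> (\<forall>A :: 'a set. is_gap A \<longrightarrow> A = {} \<or> A = UNIV)"

datatype 'a bm = Pt 'a int | Cut "'a set"

fun bm_less :: "'a::linorder bm \<Rightarrow> 'a bm \<Rightarrow> bool" where
  "bm_less (Pt x i) (Pt y j) \<longleftrightarrow> x < y \<or> (x = y \<and> i < j)"
| "bm_less (Pt x i) (Cut A) \<longleftrightarrow> x \<in> A"
| "bm_less (Cut A) (Pt y j) \<longleftrightarrow> y \<notin> A"
| "bm_less (Cut A) (Cut B) \<longleftrightarrow> A \<subset> B"

definition bm_le :: "'a::linorder bm \<Rightarrow> 'a bm \<Rightarrow> bool" where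
  "bm_le a b \<longleftrightarrow> a = b \<or> bm_less a b"

text \<open>inf = Cut {}, sup = Cut UNIV are always included.\<close>
definition bmX :: "'a::linorder bm set" where
  "bmX = {Pt x j | x j. j \<in> {-1, 0, 1}} \<union> Cut ` {A. is_gap A} \<union> {Cut {}, Cut UNIV}"

text \<open>X is identified with X \<times> {0}.\<close>
definition X0 :: "'a bm set" where
  "X0 = {Pt x 0 | x. True}"

definition bmTop :: "'a::linorder bm topology" where
  "bmTop = topology_generated_by
     (insert bmX ({{z \<in> bmX. bm_less a z} | a. a \<in> bmX} \<union> {{z \<in> bmX. bm_less z a} | a. a \<in> bmX}))"

fun act :: "('a \<Rightarrow> 'a) \<Rightarrow> 'a bm \<Rightarrow> 'a bm" where
  "act g (Pt x j) = Pt (g x) j"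
| "act g (Cut A) = Cut (g ` A)"

definition Gtop :: "('a::linorder \<Rightarrow> 'a) topology" where
  "Gtop = subtopology (product_topology (\<lambda>_. discrete_topology UNIV) UNIV) aut"

definition nbhd_id :: "('a::linorder \<Rightarrow> 'a) set \<Rightarrow> bool" where
  "nbhd_id N \<longleftrightarrow> N \<subseteq> aut \<and> (\<exists>U. openin Gtop U \<and> id \<in> U \<and> U \<subseteq> N)"

definition triple_prod :: "('a \<Rightarrow> 'a) set \<Rightarrow> ('a \<Rightarrow> 'a) \<Rightarrow> ('a \<Rightarrow> 'a) set \<Rightarrow> ('a \<Rightarrow> 'a) set" where
  "triple_prod N g S = {n \<circ> g \<circ> s | n s. n \<in> N \<and> s \<in> S}"

definition stab :: "'a::linorder bm set \<Rightarrow> ('a \<Rightarrow> 'a) set" where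
  "stab \<sigma> = {h \<in> aut. \<forall>z\<in>\<sigma>. act h z = z}"

definition cover_ent :: "'b set set \<Rightarrow> ('b \<times> 'b) set" where
  "cover_ent C = \<Union>{A \<times> A | A. A \<in> C}"

definition R_Sigma_bm :: "(('a::linorder \<Rightarrow> 'a) \<times> ('a \<Rightarrow> 'a)) set set" where
  "R_Sigma_bm = {E. E \<subseteq> aut \<times> aut \<and> (\<exists>N \<sigma>. nbhd_id N \<and> finite \<sigma> \<and> \<sigma> \<subseteq> bmX \<and>
      cover_ent {triple_prod N g (stab \<sigma>) | g. g \<in> aut} \<subseteq> E)}"

definition roelcke :: "(('a::linorder \<Rightarrow> 'a) \<times> ('a \<Rightarrow> 'a)) set set" where
  "roelcke = {E. E \<subseteq> aut \<times> aut \<and> (\<exists>N. nbhd_id N \<and>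
      cover_ent {triple_prod N g N | g. g \<in> aut} \<subseteq> E)}"

definition roelcke_precompact :: "'a::linorder itself \<Rightarrow> bool" where
  "roelcke_precompact _ \<longleftrightarrow> (\<forall>N :: ('a \<Rightarrow> 'a) set. nbhd_id N \<longrightarrow>
      (\<exists>F. finite F \<and> F \<subseteq> aut \<and> aut \<subseteq> (\<Union>g\<in>F. triple_prod N g N)))"

text \<open>the unique uniformity of a compact Hausdorff space: neighbourhoods of the diagonal\<close>
definition cH_unif :: "'b topology \<Rightarrow> ('b \<times> 'b) set set" where
  "cH_unif T = {E. E \<subseteq> topspace T \<times> topspace T \<and>
      (\<exists>U. openin (prod_topology T T) U \<and> Id_on (topspace T) \<subseteq> U \<and> U \<subseteq> E)}"

text \<open>(T, j) is a (compact) completion of the uniform space (S, Phi): T compact Hausdorff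
  (hence complete in its unique uniformity), j injective with dense image, and Phi is the
  uniformity induced by j.\<close>
definition is_compact_completion ::
  "'b topology \<Rightarrow> ('c \<Rightarrow> 'b) \<Rightarrow> 'c set \<Rightarrow> ('c \<times> 'c) set set \<Rightarrow> bool" where
  "is_compact_completion T j S \<Phi> \<longleftrightarrow> compact_space T \<and> Hausdorff_space T \<and>
      j ` S \<subseteq> topspace T \<and> inj_on j S \<and> T closure_of (j ` S) = topspace T \<and>
      \<Phi> = {E. E \<subseteq> S \<times> S \<and> (\<exists>D\<in>cH_unif T. {(x, y). x \<in> S \<and> y \<in> S \<and> (j x, j y) \<in> D} \<subseteq> E)}"

definition comp_le :: "'b topology \<Rightarrow> (('a::linorder \<Rightarrow> 'a) \<Rightarrow> 'b) \<Rightarrow> 'c topology \<Rightarrow> (('a \<Rightarrow> 'a) \<Rightarrow> 'c) \<Rightarrow> bool" where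
  "comp_le T1 j1 T2 j2 \<longleftrightarrow> (\<exists>\<phi>. continuous_map T2 T1 \<phi> \<and> (\<forall>g\<in>aut. \<phi> (j2 g) = j1 g))"

definition comp_iso :: "'b topology \<Rightarrow> (('a::linorder \<Rightarrow> 'a) \<Rightarrow> 'b) \<Rightarrow> 'c topology \<Rightarrow> (('a \<Rightarrow> 'a) \<Rightarrow> 'c) \<Rightarrow> bool" where
  "comp_iso T1 j1 T2 j2 \<longleftrightarrow> (\<exists>\<phi>. homeomorphic_map T1 T2 \<phi> \<and> (\<forall>g\<in>aut. \<phi> (j1 g) = j2 g))"

definition iota_m :: "('a::linorder \<Rightarrow> 'a) \<Rightarrow> ('a bm \<Rightarrow> 'a bm)" where
  "iota_m g = restrict (act g) bmX"

definition eG :: "('a::linorder bm \<Rightarrow> 'a bm) set" where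
  "eG = (product_topology (\<lambda>_. bmTop) bmX) closure_of (iota_m ` aut)"

definition eGtop :: "('a::linorder bm \<Rightarrow> 'a bm) topology" where
  "eGtop = subtopology (product_topology (\<lambda>_. bmTop) bmX) eG"

definition ext_act :: "'b topology \<Rightarrow> (('a::linorder \<Rightarrow> 'a) \<Rightarrow> 'b) \<Rightarrow> ('a \<Rightarrow> 'a) \<Rightarrow> 'b \<Rightarrow> 'b" where
  "ext_act T j g = (SOME h. continuous_map T T h \<and> (\<forall>k\<in>aut. h (j k) = j (g \<circ> k)))"

definition iota_K :: "'b topology \<Rightarrow> (('a::linorder \<Rightarrow> 'a) \<Rightarrow> 'b) \<Rightarrow> ('a \<Rightarrow> 'a) \<Rightarrow> ('b \<Rightarrow> 'b)" where
  "iota_K T j g = restrict (ext_act T j g) (topspace T)"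

definition ellis_top :: "'b topology \<Rightarrow> (('a::linorder \<Rightarrow> 'a) \<Rightarrow> 'b) \<Rightarrow> ('b \<Rightarrow> 'b) topology" where
  "ellis_top T j = subtopology (product_topology (\<lambda>_. T) (topspace T))
      ((product_topology (\<lambda>_. T) (topspace T)) closure_of (iota_K T j ` aut))"

definition brModel :: "('a::linorder \<Rightarrow> 'a bm) set" where
  "brModel = {f \<in> (\<Pi>\<^sub>E x\<in>UNIV. bmX). (\<forall>x y. x \<le> y \<longrightarrow> bm_le (f x) (f y))
      \<and> (\<forall>x y. x \<noteq> y \<and> f x = f y \<longrightarrow> f x \<notin> X0)}"

definition brTop :: "('a::linorder \<Rightarrow> 'a bm) topology" where
  "brTop = subtopology (product_topology (\<lambda>_. bmTop) UNIV) brModel"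

definition j_d :: "('a::linorder \<Rightarrow> 'a) \<Rightarrow> ('a \<Rightarrow> 'a bm)" where
  "j_d g = (\<lambda>x. Pt (g x) 0)"

end

theory Submission
  imports Defs
begin

text \<open>
  A point \<open>z\<close> of \<open>bmX\<close> is determined by its code, the function sending \<open>y \<in> X\<close> to the sign of \<open>z - y\<close>,
  and the order topology of \<open>bmX\<close> is the topology of pointwise convergence of codes. Hence all the
  spaces involved are topologized by finite-valued coordinates, and entourages are described by
  agreement on finitely many of them. For finite sets \<open>Y\<close> of points of \<open>X\<close> and \<open>Z\<close> of points of \<open>X\<close>
  and gaps, two automorphisms \<open>g\<close>, \<open>h\<close> satisfy \<open>code (g z) y = code (h z) y\<close>
  for \<open>z \<in> Z\<close>, \<open>y \<in> Y\<close> exactly when \<open>h \<in> St\<^sub>Y g St\<^sub>Z\<close>: the finite partial map \<open>h\<inverse> y \<mapsto> g\<inverse> y\<close> extends to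
  an automorphism fixing the points and gaps in \<open>Z\<close>. This identifies the uniformities. Density of \<open>G\<close> in
  the two function spaces is a finite interpolation problem, solved one point at a time by
  ultrahomogeneity. Finally \<open>f \<mapsto> (t \<mapsto> f \<circ> t)\<close> embeds \<open>e\<^sub>K G\<close> into the self-maps of the Roelcke
  completion, since every point of \<open>bmX\<close> is a value of some element of it.
\<close>

section \<open>Topologies and uniformities given by discrete coordinates\<close>

text \<open>Ultrahomogeneity moves finite sets of points only, whereas \<open>bmX\<close> also has
  gaps and the side copies (x,-1) and (x,1). Side copies are harmless: an automorphism fixing one of
  them fixes x, so every stabilizer is that of a set of points and gaps. Gaps are the obstacle: a
  gap is an infinite datum, an extension of a finite map may move it, and it has to be fenced in by
  fixed points of X. Three signs are kept, since the value 0 at y singles out the isolated point y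
  and so records equality as well as side. With finitely many signs there are finitely many patterns
  on a finite set of coordinates, which is the source of precompactness. A function is a code as
  soon as it satisfies conditions on at most two coordinates at a time, so the codes are closed in
  the cube of all sign functions, which is the source of compactness. As all completions here are
  compact, comparison maps come from closed graphs and closed images. The ends inf and sup are fixed
  by all automorphisms and bound each finite interpolation problem from both sides.\<close>

definition code_cell :: "'b topology \<Rightarrow> ('k \<Rightarrow> 'b \<Rightarrow> 'v) \<Rightarrow> 'k set \<Rightarrow> 'b \<Rightarrow> 'b set" where
  "code_cell T c F z = {w \<in> topspace T. \<forall>k\<in>F. c k w = c k z}"

text \<open>This is the initial topology for the maps \<open>c k\<close> into discrete spaces,
  expressed by finite agreement so that no topology on the value type occurs.\<close>

definition coded_by :: "'b topology \<Rightarrow> ('k \<Rightarrow> 'b \<Rightarrow> 'v) \<Rightarrow> bool" where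
  "coded_by T c \<longleftrightarrow> (\<forall>U. openin T U \<longleftrightarrow>
     U \<subseteq> topspace T \<and> (\<forall>z\<in>U. \<exists>F. finite F \<and> code_cell T c F z \<subseteq> U))"

lemma code_cell_mono: "F \<subseteq> F' \<Longrightarrow> code_cell T c F' z \<subseteq> code_cell T c F z"
  by (auto simp: code_cell_def)

lemma mem_code_cell_self: "z \<in> topspace T \<Longrightarrow> z \<in> code_cell T c F z"
  by (auto simp: code_cell_def)

lemma coded_byI:
  assumes open_cell: "\<And>k z. z \<in> topspace T \<Longrightarrow> openin T {w \<in> topspace T. c k w = c k z}"
    and cell_in: "\<And>U z. openin T U \<Longrightarrow> z \<in> U \<Longrightarrow> \<exists>F. finite F \<and> code_cell T c F z \<subseteq> U"
  shows "coded_by T c"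
  unfolding coded_by_def
proof (intro allI iffI conjI)
  fix U assume U: "openin T U"
  then show "U \<subseteq> topspace T" by (rule openin_subset)
  show "\<forall>z\<in>U. \<exists>F. finite F \<and> code_cell T c F z \<subseteq> U"
    using cell_in[OF U] by blast
next
  fix U assume U: "U \<subseteq> topspace T \<and> (\<forall>z\<in>U. \<exists>F. finite F \<and> code_cell T c F z \<subseteq> U)"
  have cell: "openin T (code_cell T c F z)" if "z \<in> topspace T" "finite F" for F z
    using that(2)
  proof induction
    case empty
    then show ?case by (simp add: code_cell_def)
  next
    case (insert k F)
    have "code_cell T c (insert k F) z = {w \<in> topspace T. c k w = c k z} \<inter> code_cell T c F z"
      by (auto simp: code_cell_def)
    then show ?case using insert open_cell[OF that(1)] by auto
  qed
  show "openin T U"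
  proof (subst openin_subopen, intro ballI)
    fix z assume "z \<in> U"
    then obtain F where "finite F" "code_cell T c F z \<subseteq> U" using U by blast
    then show "\<exists>V. openin T V \<and> z \<in> V \<and> V \<subseteq> U"
      using cell mem_code_cell_self U \<open>z \<in> U\<close> by (metis subsetD)
  qed
qed

lemma coded_by_open_contains_cell:
  "coded_by T c \<Longrightarrow> openin T U \<Longrightarrow> z \<in> U \<Longrightarrow> \<exists>F. finite F \<and> code_cell T c F z \<subseteq> U"
  by (auto simp: coded_by_def)

lemma openin_code_cell:
  assumes "coded_by T c" "finite F"
  shows "openin T (code_cell T c F z)"
proof -
  have "code_cell T c F w \<subseteq> code_cell T c F z" if "w \<in> code_cell T c F z" for w
    using that by (auto simp: code_cell_def)
  moreover have "code_cell T c F z \<subseteq> topspace T" by (auto simp: code_cell_def)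
  ultimately show ?thesis using assms unfolding coded_by_def by blast
qed

text \<open>The identity is the only coordinate, hence the index type \<open>unit\<close>. The pairs
  \<open>(i, k::unit)\<close> in later codings of products of discrete spaces stem from
  here.\<close>

lemma coded_by_discrete: "coded_by (discrete_topology S) (\<lambda>_::unit. id)"
  by (rule coded_byI) (auto simp: code_cell_def intro!: exI[of _ UNIV])

lemma coded_by_subtopology:
  assumes "coded_by T c"
  shows "coded_by (subtopology T S) c"
proof (rule coded_byI)
  fix k z assume "z \<in> topspace (subtopology T S)"
  have "{w \<in> topspace (subtopology T S). c k w = c k z} = code_cell T c {k} z \<inter> S"
    by (auto simp: code_cell_def)
  then show "openin (subtopology T S) {w \<in> topspace (subtopology T S). c k w = c k z}"
    using openin_code_cell[OF assms] by (metis finite.emptyI finite.insertI openin_subtopology_Int)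
next
  fix U z assume U: "openin (subtopology T S) U" "z \<in> U"
  then obtain V where V: "openin T V" "U = V \<inter> S" by (auto simp: openin_subtopology)
  then obtain F where "finite F" "code_cell T c F z \<subseteq> V"
    using coded_by_open_contains_cell[OF assms] U by blast
  then show "\<exists>F. finite F \<and> code_cell (subtopology T S) c F z \<subseteq> U"
    using V by (intro exI[of _ F]) (auto simp: code_cell_def)
qed

lemma coded_by_product_topology:
  fixes c :: "'k \<Rightarrow> 'b \<Rightarrow> 'v" and I :: "'i set"
  assumes "coded_by T c"
  shows "coded_by (product_topology (\<lambda>_. T) I) (\<lambda>(i, k) f. c k (f i))"
proof (rule coded_byI)
  fix p :: "'i \<times> 'k" and f0 assume f0: "f0 \<in> topspace (product_topology (\<lambda>_. T) I)"
  obtain i k where p: "p = (i, k)" by force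
  let ?W = "{f \<in> topspace (product_topology (\<lambda>_. T) I). (case p of (i, k) \<Rightarrow> \<lambda>f. c k (f i)) f
     = (case p of (i, k) \<Rightarrow> \<lambda>f. c k (f i)) f0}"
  show "openin (product_topology (\<lambda>_. T) I) ?W"
  proof (cases "i \<in> I")
    case True
    have W: "?W = {f \<in> topspace (product_topology (\<lambda>_. T) I). f i \<in> code_cell T c {k} (f0 i)}"
      using p True by (auto simp: code_cell_def)
    have "continuous_map (product_topology (\<lambda>_. T) I) T (\<lambda>f. f i)"
      using True by (rule continuous_map_product_projection)
    from openin_continuous_map_preimage[OF this openin_code_cell[OF assms]]
    show ?thesis unfolding W by simp
  next
    case False
    \<comment> \<open>Members of the product are \<open>undefined\<close> outside \<open>I\<close>,
      so a coordinate with index outside \<open>I\<close> is constant.\<close>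
    have W: "?W = topspace (product_topology (\<lambda>_. T) I)"
    proof -
      have "f i = f0 i" if "f \<in> topspace (product_topology (\<lambda>_. T) I)" for f
        using that f0 False unfolding topspace_product_topology by (metis PiE_arb)
      then show ?thesis unfolding p by auto
    qed
    show ?thesis unfolding W by (rule openin_topspace)
  qed
next
  fix U f assume U: "openin (product_topology (\<lambda>_. T) I) U" "f \<in> U"
  then obtain V where V: "finite {i \<in> I. V i \<noteq> topspace T}" "\<And>i. i \<in> I \<Longrightarrow> openin T (V i)"
      "f \<in> Pi\<^sub>E I V" "Pi\<^sub>E I V \<subseteq> U"
    unfolding openin_product_topology_alt by meson
  have "\<forall>i\<in>I. \<exists>F. finite F \<and> code_cell T c F (f i) \<subseteq> V i"
    using V coded_by_open_contains_cell[OF assms] by (metis PiE_mem)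
  then obtain F where F: "\<And>i. i \<in> I \<Longrightarrow> finite (F i)" "\<And>i. i \<in> I \<Longrightarrow> code_cell T c (F i) (f i) \<subseteq> V i"
    by metis
  let ?F = "Sigma {i \<in> I. V i \<noteq> topspace T} F"
  have "code_cell (product_topology (\<lambda>_. T) I) (\<lambda>(i, k) f. c k (f i)) ?F f \<subseteq> Pi\<^sub>E I V"
  proof
    fix h assume h: "h \<in> code_cell (product_topology (\<lambda>_. T) I) (\<lambda>(i, k) f. c k (f i)) ?F f"
    then have hT: "h \<in> (\<Pi>\<^sub>E i\<in>I. topspace T)" by (simp add: code_cell_def)
    show "h \<in> Pi\<^sub>E I V"
    proof (rule PiE_I)
      fix i assume i: "i \<in> I"
      show "h i \<in> V i"
      proof (cases "V i = topspace T")
        case True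
        then show ?thesis using hT i by (auto simp: PiE_mem)
      next
        case False
        then have "h i \<in> code_cell T c (F i) (f i)"
          using h i hT by (auto simp: code_cell_def)
        then show ?thesis using F(2)[OF i] by blast
      qed
    qed (rule PiE_arb[OF hT])
  qed
  moreover have "finite ?F" by (rule finite_SigmaI[OF V(1)]) (rule F(1), simp)
  ultimately show "\<exists>F. finite F \<and> code_cell (product_topology (\<lambda>_. T) I) (\<lambda>(i, k) f. c k (f i)) F f \<subseteq> U"
    using V(4) by blast
qed

lemma coded_by_in_closure_of:
  assumes "coded_by T c" "S \<subseteq> topspace T"
  shows "z \<in> T closure_of S \<longleftrightarrow>
    z \<in> topspace T \<and> (\<forall>F. finite F \<longrightarrow> (\<exists>s\<in>S. \<forall>k\<in>F. c k s = c k z))"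
proof (intro iffI conjI allI impI)
  assume z: "z \<in> T closure_of S"
  then show zT: "z \<in> topspace T" by (simp add: in_closure_of)
  fix F :: "'b set" assume "finite F"
  then have "\<exists>s\<in>S. s \<in> code_cell T c F z"
    using z openin_code_cell[OF assms(1)] mem_code_cell_self[OF zT] by (metis in_closure_of)
  then show "\<exists>s\<in>S. \<forall>k\<in>F. c k s = c k z" by (auto simp: code_cell_def)
next
  assume z: "z \<in> topspace T \<and> (\<forall>F. finite F \<longrightarrow> (\<exists>s\<in>S. \<forall>k\<in>F. c k s = c k z))"
  show "z \<in> T closure_of S"
    unfolding in_closure_of
  proof (intro conjI allI impI)
    fix U assume "z \<in> U \<and> openin T U"
    then obtain F where F: "finite F" "code_cell T c F z \<subseteq> U"
      using coded_by_open_contains_cell[OF assms(1)] by blast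
    then obtain s where "s \<in> S" "\<forall>k\<in>F. c k s = c k z" using z by blast
    then show "\<exists>y. y \<in> S \<and> y \<in> U" using F assms(2) by (auto simp: code_cell_def)
  qed (use z in simp)
qed

lemma coded_by_Hausdorff_space:
  assumes "coded_by T c"
    and "\<And>z w. z \<in> topspace T \<Longrightarrow> w \<in> topspace T \<Longrightarrow> (\<And>k. c k z = c k w) \<Longrightarrow> z = w"
  shows "Hausdorff_space T"
  unfolding Hausdorff_space_def
proof (intro allI impI)
  fix z w assume zw: "z \<in> topspace T \<and> w \<in> topspace T \<and> z \<noteq> w"
  then obtain k where k: "c k z \<noteq> c k w" using assms(2) by blast
  then show "\<exists>U V. openin T U \<and> openin T V \<and> z \<in> U \<and> w \<in> V \<and> disjnt U V"
    using zw openin_code_cell[OF assms(1), of "{k}"] mem_code_cell_self[of _ T c "{k}"]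
    by (intro exI[of _ "code_cell T c {k} z"] exI[of _ "code_cell T c {k} w"])
      (auto simp: disjnt_def code_cell_def)
qed

lemma coded_by_continuous_map:
  assumes "coded_by T c" "coded_by T' c'" "f ` topspace T \<subseteq> topspace T'"
    and fin: "\<And>k. \<exists>F. finite F \<and> (\<forall>z\<in>topspace T. \<forall>w\<in>topspace T.
                (\<forall>i\<in>F. c i z = c i w) \<longrightarrow> c' k (f z) = c' k (f w))"
  shows "continuous_map T T' f"
  unfolding continuous_map_def
proof (intro conjI allI impI)
  show "f \<in> topspace T \<rightarrow> topspace T'" using assms(3) by auto
  fix U assume U: "openin T' U"
  obtain F where F: "\<And>k. finite (F k)" "\<And>k z w. z \<in> topspace T \<Longrightarrow> w \<in> topspace T \<Longrightarrow>
      (\<forall>i\<in>F k. c i z = c i w) \<Longrightarrow> c' k (f z) = c' k (f w)"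
    using fin by metis
  have "\<exists>H. finite H \<and> code_cell T c H z \<subseteq> {x \<in> topspace T. f x \<in> U}"
    if z: "z \<in> topspace T" "f z \<in> U" for z
  proof -
    obtain K where K: "finite K" "code_cell T' c' K (f z) \<subseteq> U"
      using coded_by_open_contains_cell[OF assms(2) U z(2)] by blast
    have "code_cell T c (\<Union>(F ` K)) z \<subseteq> {x \<in> topspace T. f x \<in> U}"
    proof
      fix w assume w: "w \<in> code_cell T c (\<Union>(F ` K)) z"
      then have wT: "w \<in> topspace T" by (simp add: code_cell_def)
      have "c' k (f w) = c' k (f z)" if "k \<in> K" for k
        using F(2)[OF wT z(1), of k] w that by (auto simp: code_cell_def)
      then have "f w \<in> code_cell T' c' K (f z)" using wT assms(3) by (auto simp: code_cell_def)
      then show "w \<in> {x \<in> topspace T. f x \<in> U}" using K wT by auto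
    qed
    then show ?thesis using K F(1) by (intro exI[of _ "\<Union>(F ` K)"]) auto
  qed
  then show "openin T {x \<in> topspace T. f x \<in> U}"
    using assms(1) unfolding coded_by_def by blast
qed

text \<open>Codes map \<open>T\<close> into a cube with finite factors, compact by Tychonoff, and
  \<open>realize\<close> says that the image is closed. Compactness returns to \<open>T\<close>
  along a section \<open>h\<close> of the code map.\<close>

lemma coded_by_compact_space:
  fixes c :: "'k \<Rightarrow> 'b \<Rightarrow> 'v"
  assumes "coded_by T c" "finite V" "\<And>k z. z \<in> topspace T \<Longrightarrow> c k z \<in> V"
    and realize: "\<And>d. (\<And>F. finite F \<Longrightarrow> \<exists>z\<in>topspace T. \<forall>k\<in>F. c k z = d k)
                    \<Longrightarrow> \<exists>z\<in>topspace T. \<forall>k. c k z = d k"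
  shows "compact_space T"
proof -
  let ?P = "product_topology (\<lambda>_::'k. discrete_topology V) UNIV"
  let ?S = "(\<lambda>z k. c k z) ` topspace T"
  have cP: "coded_by ?P (\<lambda>(i, k::unit) f. id (f i))"
    using coded_by_product_topology[OF coded_by_discrete] .
  have SP: "?S \<subseteq> topspace ?P" using assms(3) by auto
  have "?P closure_of ?S \<subseteq> ?S"
  proof
    fix d assume d: "d \<in> ?P closure_of ?S"
    have "\<exists>z\<in>topspace T. \<forall>k. c k z = d k"
    proof (rule realize)
      fix F :: "'k set" assume "finite F"
      then have "finite (F \<times> (UNIV :: unit set))" by simp
      then obtain s where "s \<in> ?S" "\<forall>p\<in>F \<times> UNIV. (case p of (i, k::unit) \<Rightarrow> \<lambda>f. id (f i)) s
           = (case p of (i, k::unit) \<Rightarrow> \<lambda>f. id (f i)) d"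
        using d unfolding coded_by_in_closure_of[OF cP SP] by blast
      then show "\<exists>z\<in>topspace T. \<forall>k\<in>F. c k z = d k" by auto
    qed
    then obtain z where z: "z \<in> topspace T" "\<forall>k. c k z = d k" by blast
    then have "d = (\<lambda>k. c k z)" by auto
    then show "d \<in> ?S" using z(1) by blast
  qed
  then have clos: "closedin ?P ?S" using SP closure_of_subset closure_of_eq by (metis subset_antisym)
  have "compact_space ?P"
    using assms(2) by (simp add: compact_space_product_topology compact_space_discrete_topology)
  then have comp: "compact_space (subtopology ?P ?S)"
    using clos by (simp add: closedin_compact_space compact_space_subtopology)
  define h where "h d = (SOME z. z \<in> topspace T \<and> (\<forall>k. c k z = d k))" for d
  have h: "h d \<in> topspace T \<and> (\<forall>k. c k (h d) = d k)" if "d \<in> ?S" for d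
    unfolding h_def by (rule someI_ex) (use that in auto)
  have tS: "topspace (subtopology ?P ?S) = ?S" using SP by auto
  have cont: "continuous_map (subtopology ?P ?S) T h"
  proof (rule coded_by_continuous_map[OF coded_by_subtopology[OF cP] assms(1)])
    show "h ` topspace (subtopology ?P ?S) \<subseteq> topspace T" using h tS by auto
    show "\<exists>F. finite F \<and> (\<forall>z\<in>topspace (subtopology ?P ?S). \<forall>w\<in>topspace (subtopology ?P ?S).
       (\<forall>i\<in>F. (case i of (i, k::unit) \<Rightarrow> \<lambda>f. id (f i)) z = (case i of (i, k::unit) \<Rightarrow> \<lambda>f. id (f i)) w)
          \<longrightarrow> c k (h z) = c k (h w))" for k
      unfolding tS by (intro exI[of _ "{(k, ())}"]) (use h in auto)
  qed
  have comp_h: "compactin T (h ` ?S)"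
    using image_compactin[OF _ cont] comp tS by (metis compact_space_def)
  \<comment> \<open>Distinct points may share a code at this level of generality, so
    \<open>h\<close> may miss \<open>z\<close>. It still hits a point with the code of
    \<open>z\<close>, and no open set containing that point omits \<open>z\<close>.\<close>
  have near: "\<exists>w\<in>h ` ?S. \<forall>U. openin T U \<longrightarrow> w \<in> U \<longrightarrow> z \<in> U" if z: "z \<in> topspace T" for z
  proof -
    let ?w = "h (\<lambda>k. c k z)"
    have "z \<in> U" if U: "openin T U" "?w \<in> U" for U
    proof -
      obtain F where "code_cell T c F ?w \<subseteq> U" using coded_by_open_contains_cell[OF assms(1) U] by blast
      moreover have "z \<in> code_cell T c F ?w" using h[of "\<lambda>k. c k z"] z by (auto simp: code_cell_def)
      ultimately show ?thesis by blast
    qed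
    then show ?thesis using z by blast
  qed
  have hS: "h ` ?S \<subseteq> topspace T" using h by auto
  show ?thesis
    unfolding compact_space_alt
  proof (intro allI impI)
    fix \<U> assume U: "(\<forall>U\<in>\<U>. openin T U) \<and> topspace T \<subseteq> \<Union>\<U>"
    then have "h ` ?S \<subseteq> \<Union>\<U>" using hS by blast
    then obtain \<F> where F: "finite \<F>" "\<F> \<subseteq> \<U>" "h ` ?S \<subseteq> \<Union>\<F>"
      using comp_h U unfolding compactin_def by (metis (no_types, lifting))
    have "topspace T \<subseteq> \<Union>\<F>"
    proof
      fix z assume "z \<in> topspace T"
      then obtain w where "w \<in> h ` ?S" "\<forall>U. openin T U \<longrightarrow> w \<in> U \<longrightarrow> z \<in> U" using near by blast
      then show "z \<in> \<Union>\<F>" using F U by (meson Union_iff subsetD)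
    qed
    then show "\<exists>\<F>. finite \<F> \<and> \<F> \<subseteq> \<U> \<and> topspace T \<subseteq> \<Union>\<F>"
      using F by blast
  qed
qed

text \<open>The coarsest uniformity on \<open>S\<close> making every \<open>c k\<close> uniformly
  continuous into a discrete uniform space.\<close>

definition code_unif :: "'c set \<Rightarrow> ('k \<Rightarrow> 'c \<Rightarrow> 'v) \<Rightarrow> ('c \<times> 'c) set set" where
  "code_unif S c = {E. E \<subseteq> S \<times> S \<and>
     (\<exists>F. finite F \<and> {(x, y). x \<in> S \<and> y \<in> S \<and> (\<forall>k\<in>F. c k x = c k y)} \<subseteq> E)}"

lemma code_unif_mono:
  assumes "\<And>k. \<exists>F. finite F \<and> (\<forall>x\<in>S. \<forall>y\<in>S. (\<forall>i\<in>F. c' i x = c' i y) \<longrightarrow> c k x = c k y)"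
  shows "code_unif S c \<subseteq> code_unif S c'"
proof
  fix E assume "E \<in> code_unif S c"
  then obtain F where E: "E \<subseteq> S \<times> S" "finite F"
      "{(x, y). x \<in> S \<and> y \<in> S \<and> (\<forall>k\<in>F. c k x = c k y)} \<subseteq> E"
    unfolding code_unif_def by auto
  obtain H where H: "\<And>k. finite (H k)"
      "\<And>k x y. x \<in> S \<Longrightarrow> y \<in> S \<Longrightarrow> (\<forall>i\<in>H k. c' i x = c' i y) \<Longrightarrow> c k x = c k y"
    using assms by metis
  have "{(x, y). x \<in> S \<and> y \<in> S \<and> (\<forall>k\<in>\<Union>(H ` F). c' k x = c' k y)} \<subseteq> E"
  proof (intro subrelI)
    fix x y assume "(x, y) \<in> {(x, y). x \<in> S \<and> y \<in> S \<and> (\<forall>k\<in>\<Union>(H ` F). c' k x = c' k y)}"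
    then have xy: "x \<in> S" "y \<in> S" "\<And>k i. k \<in> F \<Longrightarrow> i \<in> H k \<Longrightarrow> c' i x = c' i y" by auto
    then have "\<forall>k\<in>F. c k x = c k y" using H(2)[OF xy(1,2)] by metis
    then show "(x, y) \<in> E" using E(3) xy by auto
  qed
  moreover have "finite (\<Union>(H ` F))" using E(2) H(1) by simp
  ultimately show "E \<in> code_unif S c'"
    unfolding code_unif_def using E(1) by (intro CollectI conjI exI[of _ "\<Union>(H ` F)"])
qed

text \<open>A Lebesgue number argument. Cells whose squares lie in \<open>U\<close> cover
  \<open>T\<close>; a finite subcover mentions finitely many coordinates, and agreement on all of
  them puts two points into one cell. Conversely, finite agreement is an open relation, being a
  union of rectangles of cells.\<close>

lemma cH_unif_coded:
  assumes "coded_by T c" "compact_space T"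
  shows "cH_unif T = code_unif (topspace T) c"
proof (intro equalityI subsetI)
  fix E assume "E \<in> cH_unif T"
  then obtain U where U: "E \<subseteq> topspace T \<times> topspace T" "openin (prod_topology T T) U"
      "Id_on (topspace T) \<subseteq> U" "U \<subseteq> E"
    unfolding cH_unif_def by blast
  have "\<exists>F. finite F \<and> code_cell T c F z \<times> code_cell T c F z \<subseteq> U" if z: "z \<in> topspace T" for z
  proof -
    have "(z, z) \<in> U" using U(3) z by auto
    then obtain A B where AB: "openin T A" "openin T B" "z \<in> A" "z \<in> B" "A \<times> B \<subseteq> U"
      using U(2) unfolding openin_prod_topology_alt by meson
    then obtain F G where "finite F" "code_cell T c F z \<subseteq> A" "finite G" "code_cell T c G z \<subseteq> B"
      using coded_by_open_contains_cell[OF assms(1)] by meson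
    moreover from this have "code_cell T c (F \<union> G) z \<subseteq> A" "code_cell T c (F \<union> G) z \<subseteq> B"
      using code_cell_mono[of F "F \<union> G" T c z] code_cell_mono[of G "F \<union> G" T c z] by auto
    ultimately show ?thesis
      using AB(5) by (meson Sigma_mono finite_UnI subset_trans)
  qed
  then obtain F where F: "\<And>z. z \<in> topspace T \<Longrightarrow> finite (F z)"
      "\<And>z. z \<in> topspace T \<Longrightarrow> code_cell T c (F z) z \<times> code_cell T c (F z) z \<subseteq> U"
    by metis
  let ?C = "(\<lambda>z. code_cell T c (F z) z) ` topspace T"
  have "(\<forall>V\<in>?C. openin T V) \<and> topspace T \<subseteq> \<Union>?C"
  proof (intro conjI ballI subsetI)
    show "openin T V" if "V \<in> ?C" for V using that openin_code_cell[OF assms(1) F(1)] by auto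
    show "x \<in> \<Union>?C" if "x \<in> topspace T" for x using that mem_code_cell_self[OF that] by (rule UN_I)
  qed
  then obtain \<F> where \<F>: "finite \<F>" "\<F> \<subseteq> ?C" "topspace T \<subseteq> \<Union>\<F>"
    using assms(2) unfolding compact_space_alt by meson
  obtain K where "finite K" "K \<subseteq> topspace T" "\<F> = (\<lambda>z. code_cell T c (F z) z) ` K"
    using finite_subset_image[OF \<F>(1,2)] by blast
  then have K: "finite K" "K \<subseteq> topspace T" "topspace T \<subseteq> (\<Union>z\<in>K. code_cell T c (F z) z)"
    using \<F>(3) by auto
  have "(x, y) \<in> E" if xy: "x \<in> topspace T" "y \<in> topspace T" "\<forall>k\<in>\<Union>(F ` K). c k x = c k y" for x y
  proof -
    obtain z where z: "z \<in> K" "x \<in> code_cell T c (F z) z" using K(3) xy(1) by blast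
    then have "y \<in> code_cell T c (F z) z" using xy by (auto simp: code_cell_def)
    then show ?thesis using z F(2)[of z] K(2) U(4) by blast
  qed
  moreover have "finite (\<Union>(F ` K))" using K F(1) by auto
  ultimately show "E \<in> code_unif (topspace T) c"
    unfolding code_unif_def using U(1) by blast
next
  fix E assume "E \<in> code_unif (topspace T) c"
  then obtain F where E: "E \<subseteq> topspace T \<times> topspace T" "finite F"
      "{(x, y). x \<in> topspace T \<and> y \<in> topspace T \<and> (\<forall>k\<in>F. c k x = c k y)} \<subseteq> E" (is "?U \<subseteq> E")
    unfolding code_unif_def by auto
  have "openin (prod_topology T T) ?U"
    unfolding openin_prod_topology_alt
  proof (intro allI impI)
    fix x y assume xy: "(x, y) \<in> ?U"
    have "code_cell T c F x \<times> code_cell T c F y \<subseteq> ?U"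
      using xy by (auto simp: code_cell_def)
    then show "\<exists>V W. openin T V \<and> openin T W \<and> x \<in> V \<and> y \<in> W \<and> V \<times> W \<subseteq> ?U"
      using xy openin_code_cell[OF assms(1) E(2)] mem_code_cell_self[of _ T c F]
      by (intro exI[of _ "code_cell T c F x"] exI[of _ "code_cell T c F y"] conjI) auto
  qed
  moreover have "Id_on (topspace T) \<subseteq> ?U" by auto
  ultimately show "E \<in> cH_unif T" unfolding cH_unif_def using E by blast
qed

section \<open>Compact completions and the extension of maps to them\<close>

lemma coded_by_compact_completionI:
  assumes T: "coded_by T c" "compact_space T" "Hausdorff_space T"
    and j: "j ` S \<subseteq> topspace T" "inj_on j S" "T closure_of (j ` S) = topspace T"
    and \<Phi>: "\<Phi> = code_unif S (\<lambda>k x. c k (j x))"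
  shows "is_compact_completion T j S \<Phi>"
proof -
  have "code_unif S (\<lambda>k x. c k (j x)) =
      {E. E \<subseteq> S \<times> S \<and> (\<exists>D\<in>cH_unif T. {(x, y). x \<in> S \<and> y \<in> S \<and> (j x, j y) \<in> D} \<subseteq> E)}" (is "?L = ?R")
  proof (intro equalityI subsetI)
    fix E assume "E \<in> ?L"
    then obtain F where E: "E \<subseteq> S \<times> S" "finite F"
      "{(x, y). x \<in> S \<and> y \<in> S \<and> (\<forall>k\<in>F. c k (j x) = c k (j y))} \<subseteq> E"
      unfolding code_unif_def by auto
    let ?D = "{(x, y). x \<in> topspace T \<and> y \<in> topspace T \<and> (\<forall>k\<in>F. c k x = c k y)}"
    have "?D \<in> cH_unif T" unfolding cH_unif_coded[OF T(1,2)] code_unif_def using E(2) by auto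
    moreover have "{(x, y). x \<in> S \<and> y \<in> S \<and> (j x, j y) \<in> ?D} \<subseteq> E" using E(3) by auto
    ultimately show "E \<in> ?R" using E(1) by blast
  next
    fix E assume "E \<in> ?R"
    then obtain D where D: "E \<subseteq> S \<times> S" "D \<in> cH_unif T" "{(x, y). x \<in> S \<and> y \<in> S \<and> (j x, j y) \<in> D} \<subseteq> E"
      by blast
    then obtain F where F: "finite F"
      "{(x, y). x \<in> topspace T \<and> y \<in> topspace T \<and> (\<forall>k\<in>F. c k x = c k y)} \<subseteq> D"
      unfolding cH_unif_coded[OF T(1,2)] code_unif_def by auto
    have "{(x, y). x \<in> S \<and> y \<in> S \<and> (\<forall>k\<in>F. c k (j x) = c k (j y))} \<subseteq> E"
      using F(2) D(3) j(1) by blast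
    then show "E \<in> ?L" unfolding code_unif_def using F(1) D(1) by blast
  qed
  then show ?thesis unfolding is_compact_completion_def using assms by simp
qed

text \<open>The closure of the graph of \<open>j s \<mapsto> j' s\<close> is the graph of the extension.\<close>
lemma compact_completion_extend:
  assumes T: "is_compact_completion T j S \<Phi>"
    and T': "compact_space T'" "Hausdorff_space T'" "j' ` S \<subseteq> topspace T'"
    and unif: "\<And>D. D \<in> cH_unif T' \<Longrightarrow> {(x, y). x \<in> S \<and> y \<in> S \<and> (j' x, j' y) \<in> D} \<in> \<Phi>"
  shows "\<exists>h. continuous_map T T' h \<and> (\<forall>s\<in>S. h (j s) = j' s)"
proof -
  have jS: "j ` S \<subseteq> topspace T" and dense: "T closure_of (j ` S) = topspace T"
    and comp: "compact_space T" and haus: "Hausdorff_space T"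
    and \<Phi>: "\<Phi> = {E. E \<subseteq> S \<times> S \<and> (\<exists>D\<in>cH_unif T. {(x, y). x \<in> S \<and> y \<in> S \<and> (j x, j y) \<in> D} \<subseteq> E)}"
    using T unfolding is_compact_completion_def by auto
  let ?P = "prod_topology T T'"
  let ?G = "(\<lambda>s. (j s, j' s)) ` S"
  define R where "R = ?P closure_of ?G"
  have GP: "?G \<subseteq> topspace ?P" using jS T'(3) by auto
  have Rcl: "closedin ?P R" unfolding R_def by simp
  have GR: "?G \<subseteq> R" unfolding R_def by (rule closure_of_subset[OF GP])
  have RP: "R \<subseteq> topspace T \<times> topspace T'" using closedin_subset[OF Rcl] by simp
  have fst_closed: "closed_map ?P T fst" by (rule closed_map_fst[OF T'(1)])
  have graph_fun: "a = b" if ab: "(t, a) \<in> R" "(t, b) \<in> R" for t a b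
  proof (rule ccontr)
    assume "a \<noteq> b"
    have aT: "a \<in> topspace T'" "b \<in> topspace T'" "t \<in> topspace T" using ab RP by auto
    have reg: "regular_space T'" using T' by (simp add: compact_Hausdorff_imp_regular_space)
    have "closedin T' {b}" using T'(2) aT by (simp add: closedin_Hausdorff_singleton)
    then obtain A where A: "openin T' A" "a \<in> A" "b \<notin> T' closure_of A"
      using reg aT \<open>a \<noteq> b\<close> unfolding regular_space by (metis Diff_iff disjnt_insert1 singletonD)
    then obtain B where B: "openin T' B" "b \<in> B" "T' closure_of A \<inter> T' closure_of B = {}"
      using reg aT unfolding regular_space
      by (metis Diff_iff closedin_closure_of disjnt_def)
    \<comment> \<open>\<open>a\<close> and \<open>b\<close> have neighbourhoods with disjoint
      closures, so the complement of the product of these closures is an entourage. By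
      \<open>unif\<close>, points \<open>s\<close>, \<open>s'\<close> with \<open>j s\<close>,
      \<open>j s'\<close> both close to \<open>t\<close> cannot be sent by \<open>j'\<close> into
      \<open>A\<close> and \<open>B\<close> respectively, although both neighbourhoods are
      approached along the graph.\<close>
    let ?D = "topspace T' \<times> topspace T' - (T' closure_of A) \<times> (T' closure_of B)"
    have "closedin (prod_topology T' T') ((T' closure_of A) \<times> (T' closure_of B))"
      by (simp add: closedin_prod_Times_iff)
    then have "openin (prod_topology T' T') ?D"
      using openin_diff[OF openin_topspace] by (metis topspace_prod_topology)
    moreover have "Id_on (topspace T') \<subseteq> ?D" using B(3) by auto
    ultimately have "?D \<in> cH_unif T'" unfolding cH_unif_def by blast
    then obtain D where D: "D \<in> cH_unif T"
        "{(x, y). x \<in> S \<and> y \<in> S \<and> (j x, j y) \<in> D} \<subseteq> {(x, y). x \<in> S \<and> y \<in> S \<and> (j' x, j' y) \<in> ?D}"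
      using unif unfolding \<Phi> by blast
    then obtain U where U: "openin (prod_topology T T) U" "Id_on (topspace T) \<subseteq> U" "U \<subseteq> D"
      unfolding cH_unif_def by blast
    then have "(t, t) \<in> U" using aT by auto
    then obtain W1 W2 where W: "openin T W1" "openin T W2" "t \<in> W1" "t \<in> W2" "W1 \<times> W2 \<subseteq> U"
      using U(1) unfolding openin_prod_topology_alt by meson
    have "openin ?P (W1 \<times> A)" "openin ?P (W2 \<times> B)"
      using W A B by (auto simp: openin_prod_Times_iff)
    then obtain s s' where s: "s \<in> S" "(j s, j' s) \<in> W1 \<times> A" and s': "s' \<in> S" "(j s', j' s') \<in> W2 \<times> B"
      using ab W A B unfolding R_def in_closure_of by (smt (verit) SigmaI imageE)
    have "(j s, j s') \<in> D" using W(5) U(3) s s' by auto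
    then have "(j' s, j' s') \<in> ?D" using D(2) s s' by blast
    moreover have "j' s \<in> T' closure_of A" "j' s' \<in> T' closure_of B"
      using s s' closure_of_subset[OF openin_subset[OF A(1)]] closure_of_subset[OF openin_subset[OF B(1)]]
      by auto
    ultimately show False by blast
  qed
  \<comment> \<open>Projection along the compact factor \<open>T'\<close> is a closed map. The
    projection of \<open>R\<close> is therefore closed, and it contains a dense set.\<close>
  have tot: "\<exists>a. (t, a) \<in> R" if "t \<in> topspace T" for t
  proof -
    have "closedin T (fst ` R)" using fst_closed Rcl by (auto simp: closed_map_def)
    moreover have "j ` S \<subseteq> fst ` R" using GR by force
    ultimately have "T closure_of (j ` S) \<subseteq> fst ` R" by (rule closure_of_minimal[rotated])
    then show ?thesis using that dense by force
  qed
  define h where "h t = (THE a. (t, a) \<in> R)" for t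
  have h: "(t, a) \<in> R \<longleftrightarrow> a = h t" if "t \<in> topspace T" for t a
    unfolding h_def using tot[OF that] graph_fun by (metis the_equality)
  have "continuous_map T T' h"
    unfolding continuous_map_closedin
  proof (intro conjI allI impI)
    show "h \<in> topspace T \<rightarrow> topspace T'"
    proof
      fix x assume "x \<in> topspace T"
      then have "(x, h x) \<in> R" using h by simp
      then show "h x \<in> topspace T'" using RP by blast
    qed
    fix C assume C: "closedin T' C"
    \<comment> \<open>The same closed projection gives continuity: the preimage of a closed set is
      the projection of a closed part of the graph.\<close>
    have "{x \<in> topspace T. h x \<in> C} = fst ` (R \<inter> (topspace T \<times> C))"
    proof (intro equalityI subsetI)
      fix x assume "x \<in> {x \<in> topspace T. h x \<in> C}"
      then have "(x, h x) \<in> R \<inter> (topspace T \<times> C)" using h by simp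
      then show "x \<in> fst ` (R \<inter> (topspace T \<times> C))" by (metis fst_conv image_eqI)
    next
      fix x assume "x \<in> fst ` (R \<inter> (topspace T \<times> C))"
      then obtain a where "(x, a) \<in> R" "x \<in> topspace T" "a \<in> C" by auto
      then show "x \<in> {x \<in> topspace T. h x \<in> C}" using h by simp
    qed
    moreover have "closedin ?P (R \<inter> (topspace T \<times> C))"
      using Rcl C by (simp add: closedin_Int closedin_prod_Times_iff)
    ultimately show "closedin T {x \<in> topspace T. h x \<in> C}"
      using fst_closed by (simp add: closed_map_def)
  qed
  moreover have "\<forall>s\<in>S. h (j s) = j' s" 
  proof
    fix s assume "s \<in> S"
    then have "(j s, j' s) \<in> R" "j s \<in> topspace T" using GR jS by auto
    then show "h (j s) = j' s" using h by simp
  qed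
  ultimately show ?thesis by blast
qed

lemma compact_completion_extend_completion:
  assumes T: "is_compact_completion T j S \<Phi>" and T': "is_compact_completion T' j' S \<Phi>"
  shows "\<exists>h. continuous_map T T' h \<and> (\<forall>s\<in>S. h (j s) = j' s)"
proof (rule compact_completion_extend[OF T])
  show "compact_space T'" "Hausdorff_space T'" "j' ` S \<subseteq> topspace T'"
    using T' unfolding is_compact_completion_def by auto
  fix D assume "D \<in> cH_unif T'"
  then show "{(x, y). x \<in> S \<and> y \<in> S \<and> (j' x, j' y) \<in> D} \<in> \<Phi>"
    using T' unfolding is_compact_completion_def by blast
qed

lemma compact_completion_unique_maps:
  assumes T: "is_compact_completion T j S \<Phi>" and Y: "Hausdorff_space Y"
    and "continuous_map T Y f" "continuous_map T Y g" "\<And>s. s \<in> S \<Longrightarrow> f (j s) = g (j s)"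
    and "t \<in> topspace T"
  shows "f t = g t"
proof (rule forall_in_closure_of_eq[where X = T and S = "j ` S"])
  show "t \<in> T closure_of (j ` S)" using T assms(6) by (simp add: is_compact_completion_def)
qed (use assms in auto)

lemma compact_completion_unique:
  assumes T: "is_compact_completion T j S \<Phi>" and T': "is_compact_completion T' j' S \<Phi>"
  obtains \<phi> \<psi> where "continuous_map T T' \<phi>" "continuous_map T' T \<psi>"
    "\<And>s. s \<in> S \<Longrightarrow> \<phi> (j s) = j' s" "\<And>s. s \<in> S \<Longrightarrow> \<psi> (j' s) = j s"
    "\<And>t. t \<in> topspace T \<Longrightarrow> \<psi> (\<phi> t) = t" "\<And>t. t \<in> topspace T' \<Longrightarrow> \<phi> (\<psi> t) = t"
proof -
  obtain \<phi> where \<phi>: "continuous_map T T' \<phi>" "\<forall>s\<in>S. \<phi> (j s) = j' s"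
    using compact_completion_extend_completion[OF T T'] by blast
  obtain \<psi> where \<psi>: "continuous_map T' T \<psi>" "\<forall>s\<in>S. \<psi> (j' s) = j s"
    using compact_completion_extend_completion[OF T' T] by blast
  have H: "Hausdorff_space T" "Hausdorff_space T'"
    using T T' by (auto simp: is_compact_completion_def)
  have "\<psi> (\<phi> t) = t" if "t \<in> topspace T" for t
    using compact_completion_unique_maps[OF T H(1) continuous_map_compose[OF \<phi>(1) \<psi>(1)] continuous_map_id, of t]
      that \<phi>(2) \<psi>(2) by simp
  moreover have "\<phi> (\<psi> t) = t" if "t \<in> topspace T'" for t
    using compact_completion_unique_maps[OF T' H(2) continuous_map_compose[OF \<psi>(1) \<phi>(1)] continuous_map_id, of t]
      that \<phi>(2) \<psi>(2) by simp
  ultimately show thesis using that \<phi> \<psi> by blast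
qed

section \<open>Order structure of ultrahomogeneous chains and their compactification\<close>

lemma aut_less_iff: "g \<in> aut \<Longrightarrow> g x < g y \<longleftrightarrow> x < y"
  by (simp add: aut_def strict_mono_less)

lemma aut_eq_iff: "g \<in> aut \<Longrightarrow> g x = g y \<longleftrightarrow> x = y"
  by (auto simp: aut_def strict_mono_eq)

lemma aut_bij: "g \<in> aut \<Longrightarrow> bij g"
  by (simp add: aut_def)

lemma aut_inv_right [simp]: "g \<in> aut \<Longrightarrow> g (inv g x) = x"
  by (simp add: aut_def bij_is_surj surj_f_inv_f)

lemma aut_inv_left [simp]: "g \<in> aut \<Longrightarrow> inv g (g x) = x"
  by (simp add: aut_def bij_is_inj)

lemma autI: "(\<And>x y. x < y \<Longrightarrow> g x < g y) \<Longrightarrow> surj g \<Longrightarrow> g \<in> aut"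
  using strict_mono_imp_inj_on[of g] by (auto simp: aut_def bij_def strict_mono_def)

lemma aut_inv:
  assumes "g \<in> aut"
  shows "inv g \<in> aut"
proof (rule autI)
  show "inv g x < inv g y" if "x < y" for x y
    using that aut_less_iff[OF assms, of "inv g x" "inv g y"] assms by simp
  show "surj (inv g)" by (rule surjI[of _ g]) (use assms in simp)
qed

lemma aut_image_mem:
  assumes "g \<in> aut"
  shows "x \<in> g ` A \<longleftrightarrow> inv g x \<in> A"
proof
  show "inv g x \<in> A" if "x \<in> g ` A" using that assms by auto
  show "x \<in> g ` A" if "inv g x \<in> A" using imageI[OF that, of g] assms by simp
qed

lemma aut_comp: "g \<in> aut \<Longrightarrow> h \<in> aut \<Longrightarrow> g \<circ> h \<in> aut"
  by (auto simp: aut_def bij_comp strict_mono_def)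

lemma aut_id: "id \<in> aut"
  by (auto simp: aut_def strict_mono_def)

lemma aut_image_eq_iff:
  assumes "g \<in> aut"
  shows "g ` A = A \<longleftrightarrow> (\<forall>x. g x \<in> A \<longleftrightarrow> x \<in> A)"
proof
  show "\<forall>x. g x \<in> A \<longleftrightarrow> x \<in> A" if "g ` A = A"
    using that aut_image_mem[OF assms, of _ A] assms by (metis aut_inv_left)
  assume A: "\<forall>x. g x \<in> A \<longleftrightarrow> x \<in> A"
  have "x \<in> g ` A \<longleftrightarrow> x \<in> A" for x
    using A[THEN spec, of "inv g x"] aut_image_mem[OF assms, of x A] assms by simp
  then show "g ` A = A" by blast
qed

lemma is_gap_downward: "is_gap A \<Longrightarrow> x \<in> A \<Longrightarrow> y \<le> x \<Longrightarrow> y \<in> A"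
  by (auto simp: is_gap_def)

lemma is_gap_ex_above: "is_gap A \<Longrightarrow> x \<in> A \<Longrightarrow> \<exists>x'. x' \<in> A \<and> x < x'"
  by (auto simp: is_gap_def)

lemma is_gap_ex_below: "is_gap A \<Longrightarrow> x \<notin> A \<Longrightarrow> \<exists>x'. x' \<notin> A \<and> x' < x"
  by (auto simp: is_gap_def)

text \<open>\<open>sgn j\<close> in place of \<open>j\<close> keeps the values in {-1, 0, 1} on the
  whole datatype, also outside \<open>bmX\<close>, so \<open>code_mem\<close> holds without a
  membership condition.\<close>

fun code :: "'a::linorder bm \<Rightarrow> 'a \<Rightarrow> int" where
  "code (Pt x j) y = (if x < y then -1 else if y < x then 1 else sgn j)"
| "code (Cut A) y = (if y \<in> A then 1 else -1)"

lemma code_mem: "code z y \<in> {-1, 0, 1}"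
  by (cases z) (auto simp: sgn_if)

text \<open>The group acts on codes by translating the argument. A requirement on \<open>g\<close>
  at a test point y thus becomes a requirement on the position of \<open>inv g y\<close>, which is
  why later constructions produce the inverse of the wanted automorphism.\<close>

lemma code_act:
  assumes "g \<in> aut"
  shows "code (act g z) y = code z (inv g y)"
proof (cases z)
  case (Pt x j)
  have "g x < y \<longleftrightarrow> x < inv g y" "y < g x \<longleftrightarrow> inv g y < x"
    using aut_less_iff[OF assms, of x "inv g y"] aut_less_iff[OF assms, of "inv g y" x] assms by auto
  then show ?thesis using Pt by simp
qed (simp add: aut_image_mem[OF assms])

locale homogeneous_chain =
  fixes ty :: "'a::linorder itself"
  assumes infinite_chain: "infinite (UNIV :: 'a set)"
    and homogeneous: "ultrahomogeneous ty"
begin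

lemma extend_finite_strict_mono:
  fixes \<phi> :: "'a \<Rightarrow> 'a"
  assumes "finite D" and mono: "\<And>d e. d \<in> D \<Longrightarrow> e \<in> D \<Longrightarrow> d < e \<Longrightarrow> \<phi> d < \<phi> e"
  shows "\<exists>g\<in>aut. \<forall>d\<in>D. g d = \<phi> d"
proof -
  let ?xs = "sorted_list_of_set D"
  have "sorted_wrt (<) ?xs" by simp
  moreover have "sorted_wrt (<) (map \<phi> ?xs)"
    unfolding sorted_wrt_map
    by (rule sorted_wrt_mono_rel[where P = "(<)"]) (use mono assms(1) in auto)
  ultimately obtain g where g: "g \<in> aut" "\<forall>k<length ?xs. g (?xs ! k) = map \<phi> ?xs ! k"
    using homogeneous[unfolded ultrahomogeneous_def, THEN spec, THEN spec, of ?xs "map \<phi> ?xs"] by auto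
  have "g d = \<phi> d" if d: "d \<in> D" for d
  proof -
    obtain k where "k < length ?xs" "?xs ! k = d"
      using d set_sorted_list_of_set[OF assms(1)] in_set_conv_nth[of d ?xs] by auto
    then show ?thesis using g(2) by auto
  qed
  then show ?thesis using g(1) by blast
qed

text \<open>An infinite chain has three points p < q < r. An automorphism carrying p and r to the
  given pair carries q strictly between them.\<close>

lemma ex_between:
  assumes "(x::'a) < y"
  shows "\<exists>z. x < z \<and> z < y"
proof -
  have "\<exists>p q r :: 'a. p < q \<and> q < r"
  proof -
    have "{x, y} \<noteq> UNIV" using infinite_chain by (metis finite.emptyI finite.insertI)
    then obtain c where "c \<noteq> x" "c \<noteq> y" by auto
    then show ?thesis using assms by (metis linorder_neqE)
  qed
  then obtain p q r :: 'a where pqr: "p < q" "q < r" by blast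
  obtain g where "g \<in> aut" "\<forall>d\<in>{p, r}. g d = (if d = p then x else y)"
    using extend_finite_strict_mono[of "{p, r}" "\<lambda>d. if d = p then x else y"] assms pqr by force
  then have "g p = x" "g r = y" "g p < g q" "g q < g r" using pqr by (auto simp: aut_less_iff)
  then show ?thesis by auto
qed

lemma ex_less_pair: "\<exists>a b :: 'a. a < b"
proof -
  obtain a b :: 'a where "a \<noteq> b"
    using infinite_chain by (metis (full_types) UNIV_I finite.emptyI finite.insertI finite_subset insertI1 subsetI)
  then show ?thesis by (metis linorder_neqE)
qed

lemma ex_greater: "\<exists>y. (x::'a) < y"
proof -
  obtain a b :: 'a where "a < b" using ex_less_pair by blast
  moreover obtain g where "g \<in> aut" "g a = x"
    using extend_finite_strict_mono[of "{a}" "\<lambda>_. x"] by auto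
  ultimately show ?thesis by (metis aut_less_iff)
qed

lemma ex_smaller: "\<exists>y. y < (x::'a)"
proof -
  obtain a b :: 'a where "a < b" using ex_less_pair by blast
  moreover obtain g where "g \<in> aut" "g b = x"
    using extend_finite_strict_mono[of "{b}" "\<lambda>_. x"] by auto
  ultimately show ?thesis by (metis aut_less_iff)
qed

text \<open>X has no endpoints, so the two improper cuts satisfy the definition of a gap, and inf
  and sup need no separate treatment in \<open>Cut_mem_bmX\<close>.\<close>

lemma is_gap_empty: "is_gap ({} :: 'a set)" and is_gap_UNIV: "is_gap (UNIV :: 'a set)"
  using ex_greater ex_smaller by (auto simp: is_gap_def)

lemma Cut_mem_bmX: "Cut A \<in> bmX \<longleftrightarrow> is_gap (A :: 'a set)"
  using is_gap_empty is_gap_UNIV by (auto simp: bmX_def)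

lemma Pt_mem_bmX: "Pt (x::'a) j \<in> bmX \<longleftrightarrow> j \<in> {-1, 0, 1}"
  by (auto simp: bmX_def)

text \<open>A failure of the order must show at some test point. Density supplies it between two
  points of X: with y immediately below x, the elements (y,1) and (x,-1) would share a code. For
  gaps it comes from the missing maximum of the lower part or the missing minimum of the upper
  part.\<close>

lemma bm_le_iff_code:
  assumes "a \<in> bmX" "b \<in> bmX"
  shows "bm_le a b \<longleftrightarrow> (\<forall>y::'a. code a y \<le> code b y)"
proof (cases a; cases b)
  fix x y :: 'a and i j :: int assume ab: "a = Pt x i" "b = Pt y j"
  then have ij: "i \<in> {-1, 0, 1}" "j \<in> {-1, 0, 1}" using assms by (auto simp: Pt_mem_bmX)
  show ?thesis
  proof (cases "y < x")
    case True
    then obtain w where "y < w" "w < x" using ex_between by blast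
    then have "\<not> code a w \<le> code b w" using ab by auto
    moreover have "\<not> bm_le a b" using True ab by (auto simp: bm_le_def)
    ultimately show ?thesis by blast
  next
    case False
    then consider "x < y" | "x = y" by fastforce
    then show ?thesis
    proof cases
      case 1
      then have "code a w \<le> code b w" for w using ab ij by (auto simp: sgn_if)
      then show ?thesis using 1 ab by (auto simp: bm_le_def)
    next
      case 2
      have "(\<forall>w. code a w \<le> code b w) \<longleftrightarrow> code a x \<le> code b x"
        using ab 2 by auto
      then show ?thesis using 2 ab ij by (auto simp: bm_le_def)
    qed
  qed
next
  fix x :: 'a and i A assume ab: "a = Pt x i" "b = Cut A"
  then have i: "i \<in> {-1, 0, 1}" and A: "is_gap A" using assms by (auto simp: Pt_mem_bmX Cut_mem_bmX)
  show ?thesis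
  proof (cases "x \<in> A")
    case True
    then have "code a y \<le> code b y" for y
      using ab A code_mem[of a y] unfolding is_gap_def by (auto simp: sgn_if)
    then show ?thesis using True ab by (auto simp: bm_le_def)
  next
    case False
    then obtain x' where "x' < x" "x' \<notin> A" using is_gap_ex_above[OF A] is_gap_ex_below[OF A] by blast
    then have "\<not> code a x' \<le> code b x'" using ab by auto
    moreover have "\<not> bm_le a b" using False ab by (simp add: bm_le_def)
    ultimately show ?thesis by blast
  qed
next
  fix y :: 'a and j A assume ab: "a = Cut A" "b = Pt y j"
  then have i: "j \<in> {-1, 0, 1}" and A: "is_gap A" using assms by (auto simp: Pt_mem_bmX Cut_mem_bmX)
  show ?thesis
  proof (cases "y \<in> A")
    case False
    then have lt: "x \<in> A \<Longrightarrow> x < y" for x using is_gap_downward[OF A] by (meson not_le)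
    have "code a x \<le> code b x" for x
      using ab lt[of x] by (cases "x \<in> A") (auto simp: sgn_if)
    then show ?thesis using False ab by (auto simp: bm_le_def)
  next
    case True
    then obtain x' where "y < x'" "x' \<in> A" using is_gap_ex_above[OF A] is_gap_ex_below[OF A] by blast
    then have "\<not> code a x' \<le> code b x'" using ab by auto
    moreover have "\<not> bm_le a b" using True ab by (simp add: bm_le_def)
    ultimately show ?thesis by blast
  qed
next
  fix A B assume ab: "a = Cut A" "b = Cut B"
  have "bm_le a b \<longleftrightarrow> A \<subseteq> B" using ab by (auto simp: bm_le_def)
  also have "\<dots> \<longleftrightarrow> (\<forall>y. code a y \<le> code b y)" using ab by auto
  finally show ?thesis .
qed

lemma bm_le_antisym: "bm_le a b \<Longrightarrow> bm_le b a \<Longrightarrow> a = (b :: 'a bm)"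
  by (cases a; cases b) (auto simp: bm_le_def)

lemma code_inject:
  assumes "a \<in> bmX" "b \<in> bmX" "\<And>y. code a y = code b (y::'a)"
  shows "a = b"
  using assms by (intro bm_le_antisym) (auto simp: bm_le_iff_code)

lemma bm_le_total:
  assumes "a \<in> bmX" "b \<in> bmX"
  shows "bm_le a b \<or> bm_le b (a :: 'a bm)"
proof (cases a; cases b)
  fix A B assume ab: "a = Cut A" "b = Cut B"
  then have "is_gap A" "is_gap B" using assms by (auto simp: Cut_mem_bmX)
  then have "A \<subseteq> B \<or> B \<subseteq> A" unfolding is_gap_def by (metis linear subsetI)
  then show ?thesis using ab by (auto simp: bm_le_def)
qed (auto simp: bm_le_def)

lemma code_0_iff: "z \<in> bmX \<Longrightarrow> code z (y::'a) = 0 \<longleftrightarrow> z = Pt y 0"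
  by (cases z) (auto simp: sgn_if)

lemma code_less_iff: "z \<in> bmX \<Longrightarrow> code z (y::'a) = -1 \<longleftrightarrow> bm_le z (Pt y 0) \<and> z \<noteq> Pt y 0"
  by (cases z) (auto simp: bm_le_def sgn_if Pt_mem_bmX)

lemma code_greater_iff: "z \<in> bmX \<Longrightarrow> code z (y::'a) = 1 \<longleftrightarrow> bm_le (Pt y 0) z \<and> z \<noteq> Pt y 0"
  by (cases z) (auto simp: bm_le_def sgn_if Pt_mem_bmX)

lemma code_antimono:
  assumes "z \<in> bmX" "(x::'a) \<le> y"
  shows "code z y \<le> code z x"
  using assms code_mem[of z x] code_mem[of z y]
  by (cases z) (auto simp: sgn_if Cut_mem_bmX is_gap_def split: if_splits)

text \<open>Along X a code reads 1, then at most one 0, then -1. With the range {-1, 0, 1} this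
  property characterizes codes; \<open>realize_code\<close> is the converse.\<close>

lemma code_strict:
  assumes "z \<in> bmX" "(x::'a) < y"
  shows "code z y = -1 \<or> code z x = 1"
  using assms by (cases z) (auto simp: sgn_if Cut_mem_bmX is_gap_def split: if_splits)

lemma act_mem_bmX:
  assumes "g \<in> aut" "z \<in> bmX"
  shows "act g z \<in> (bmX :: 'a bm set)"
proof (cases z)
  case (Cut A)
  then have A: "is_gap A" using assms by (simp add: Cut_mem_bmX)
  note im = aut_image_mem[OF assms(1), of _ A]
  have less: "inv g x < inv g y \<longleftrightarrow> x < y" for x y
    using aut_less_iff[OF aut_inv[OF assms(1)]] .
  then have le: "inv g x \<le> inv g y \<longleftrightarrow> x \<le> y" for x y by (metis linorder_not_le)
  have "is_gap (g ` A)"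
    unfolding is_gap_def Ball_def Bex_def Compl_iff im
  proof (intro conjI allI impI)
    fix x y assume "inv g x \<in> A" "y \<le> x"
    then show "inv g y \<in> A" using is_gap_downward[OF A] le by blast
  next
    fix x assume "inv g x \<in> A"
    then obtain w where "w \<in> A" "inv g x < w" using is_gap_ex_above[OF A] is_gap_ex_below[OF A] by blast
    then show "\<exists>x'. inv g x' \<in> A \<and> x < x'"
      using assms(1) less[of x "g w"] by (intro exI[of _ "g w"]) simp
  next
    fix x assume "inv g x \<notin> A"
    then obtain w where "w \<notin> A" "w < inv g x" using is_gap_ex_above[OF A] is_gap_ex_below[OF A] by blast
    then show "\<exists>x'. inv g x' \<notin> A \<and> x' < x"
      using assms(1) less[of "g w" x] by (intro exI[of _ "g w"]) simp
  qed
  then show ?thesis using Cut by (simp add: Cut_mem_bmX)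
qed (use assms in \<open>auto simp: Pt_mem_bmX\<close>)

text \<open>The restriction to points and gaps is essential: no point of X lies strictly between
  \<open>Pt x 0\<close> and \<open>Pt x 1\<close>. For two points of X density applies, for a point
  and a gap the lack of extrema, for two gaps any point of the difference.\<close>

lemma separating_point:
  assumes "a \<in> bmX" "b \<in> bmX" "a \<in> X0 \<union> range Cut" "b \<in> X0 \<union> range Cut" "\<not> bm_le b a"
  shows "\<exists>x::'a. code a x = -1 \<and> code b x = 1"
proof -
  have lt: "bm_less a b" using assms bm_le_total by (auto simp: bm_le_def)
  consider x y where "a = Pt x 0" "b = Pt y 0" | x A where "a = Pt x 0" "b = Cut A"
    | A x where "a = Cut A" "b = Pt x 0" | A B where "a = Cut A" "b = Cut B"
    using assms(3,4) unfolding X0_def by blast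
  then show ?thesis
  proof cases
    case 1
    then obtain w where "x < w" "w < y" using lt ex_between[of x y] by auto
    then show ?thesis using 1 by (intro exI[of _ w]) auto
  next
    case 2
    then have "x \<in> A" "is_gap A" using lt assms by (auto simp: Cut_mem_bmX)
    then obtain x' where "x < x'" "x' \<in> A" using is_gap_ex_above by blast
    then show ?thesis using 2 by (intro exI[of _ x']) auto
  next
    case 3
    then have "x \<notin> A" "is_gap A" using lt assms by (auto simp: Cut_mem_bmX)
    then obtain x' where "x' < x" "x' \<notin> A" using is_gap_ex_below by blast
    then show ?thesis using 3 by (intro exI[of _ x']) auto
  next
    case 4
    then show ?thesis using lt by auto
  qed
qed

end

text \<open>The maximum of the witnesses works: it satisfies \<open>Q\<close> because it is itself
  one of them. Nested with the dual statement, this turns pairwise separation of two finite families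
  into separation by a single point.\<close>

lemma ex_common_above:
  fixes P :: "'b \<Rightarrow> 'a::linorder \<Rightarrow> bool"
  assumes "finite L" "L \<noteq> {}" and up: "\<And>a x y. a \<in> L \<Longrightarrow> P a x \<Longrightarrow> x \<le> y \<Longrightarrow> P a y"
    and ex: "\<And>a. a \<in> L \<Longrightarrow> \<exists>x. P a x \<and> Q x"
  shows "\<exists>x. Q x \<and> (\<forall>a\<in>L. P a x)"
  using assms
proof (induction L rule: finite_ne_induct)
  case (singleton a)
  obtain x where "P a x" "Q x" using singleton.prems(2)[of a] by blast
  then show ?case by (intro exI[of _ x]) simp
next
  case (insert a L)
  have "\<exists>x. Q x \<and> (\<forall>a\<in>L. P a x)"
  proof (rule insert.IH)
    show "P b y" if "b \<in> L" "P b x" "x \<le> y" for b x y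
      using insert.prems(1)[of b x y] that by simp
    show "\<exists>x. P b x \<and> Q x" if "b \<in> L" for b
      using insert.prems(2)[of b] that by simp
  qed
  then obtain x where x: "Q x" "\<forall>a\<in>L. P a x" by blast
  obtain y where y: "P a y" "Q y" using insert.prems(2)[of a] by blast
  have "Q (max x y)" using x y by (simp add: max_def)
  moreover have "P a (max x y)" using insert.prems(1)[of a y "max x y"] y by simp
  moreover have "P b (max x y)" if "b \<in> L" for b
    using insert.prems(1)[of b x "max x y"] x that by simp
  ultimately show ?case by blast
qed

lemma ex_common_below:
  fixes P :: "'b \<Rightarrow> 'a::linorder \<Rightarrow> bool"
  assumes "finite L" "L \<noteq> {}" and down: "\<And>a x y. a \<in> L \<Longrightarrow> P a x \<Longrightarrow> y \<le> x \<Longrightarrow> P a y"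
    and ex: "\<And>a. a \<in> L \<Longrightarrow> \<exists>x. P a x \<and> Q x"
  shows "\<exists>x. Q x \<and> (\<forall>a\<in>L. P a x)"
  using assms
proof (induction L rule: finite_ne_induct)
  case (singleton a)
  obtain x where "P a x" "Q x" using singleton.prems(2)[of a] by blast
  then show ?case by (intro exI[of _ x]) simp
next
  case (insert a L)
  have "\<exists>x. Q x \<and> (\<forall>a\<in>L. P a x)"
  proof (rule insert.IH)
    show "P b y" if "b \<in> L" "P b x" "y \<le> x" for b x y
      using insert.prems(1)[of b x y] that by simp
    show "\<exists>x. P b x \<and> Q x" if "b \<in> L" for b
      using insert.prems(2)[of b] that by simp
  qed
  then obtain x where x: "Q x" "\<forall>a\<in>L. P a x" by blast
  obtain y where y: "P a y" "Q y" using insert.prems(2)[of a] by blast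
  have "Q (min x y)" using x y by (simp add: min_def)
  moreover have "P a (min x y)" using insert.prems(1)[of a y "min x y"] y by simp
  moreover have "P b (min x y)" if "b \<in> L" for b
    using insert.prems(1)[of b x "min x y"] x that by simp
  ultimately show ?case by blast
qed

section \<open>The order topology of \<open>bmX\<close> as a compact Hausdorff topology of
  codes\<close>

context homogeneous_chain
begin

lemma bm_less_iff_not_le: "a \<in> bmX \<Longrightarrow> b \<in> bmX \<Longrightarrow> bm_less a b \<longleftrightarrow> \<not> bm_le b (a :: 'a bm)"
proof
  show "\<not> bm_le b a" if "bm_less a b"
    using that by (cases a; cases b) (auto simp: bm_le_def)
  show "bm_less a b" if "a \<in> bmX" "b \<in> bmX" "\<not> bm_le b a"
    using bm_le_total[of a b] that by (auto simp: bm_le_def)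
qed

lemma topspace_bmTop: "topspace (bmTop :: 'a bm topology) = bmX"
  unfolding bmTop_def topology_generated_by_topspace by auto

text \<open>A single coordinate condition describes an open ray or an isolated point. Conversely,
  \<open>bm_le_iff_code\<close> shows a strict inequality at one test point y, and fixing the code
  at y keeps a point inside the ray.\<close>

lemma coded_by_bmTop: "coded_by (bmTop :: 'a bm topology) (\<lambda>y z. code z y)"
proof (rule coded_byI, unfold topspace_bmTop)
  fix k :: 'a and z :: "'a bm"
  have up: "openin bmTop {w \<in> bmX. bm_less a w}" and down: "openin bmTop {w \<in> bmX. bm_less w a}"
    if "a \<in> bmX" for a :: "'a bm"
    unfolding bmTop_def by (rule topology_generated_by_Basis, use that in blast)+
  have k: "Pt k i \<in> bmX" if "i \<in> {-1, 0, 1}" for i using that by (simp add: Pt_mem_bmX)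
  have gr: "code w k = 1 \<longleftrightarrow> bm_less (Pt k 0) w" and le: "code w k = -1 \<longleftrightarrow> bm_less w (Pt k 0)"
    if "w \<in> bmX" for w
    using that by (cases w; auto simp: sgn_if Pt_mem_bmX)+
  consider "code z k = 1" | "code z k = -1" | "code z k = 0" using code_mem[of z k] by auto
  then show "openin bmTop {w \<in> bmX. code w k = code z k}"
  proof cases
    case 1
    then have "{w \<in> bmX. code w k = code z k} = {w \<in> bmX. bm_less (Pt k 0) w}"
      using gr by auto
    then show ?thesis using up[OF k[of 0]] by simp
  next
    case 2
    then have "{w \<in> bmX. code w k = code z k} = {w \<in> bmX. bm_less w (Pt k 0)}"
      using le by auto
    then show ?thesis using down[OF k[of 0]] by simp
  next
    case 3
    \<comment> \<open>The side copies (k,-1) and (k,1) isolate k, so the condition that the code at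
      k be 0 is open.\<close>
    have "w = Pt k 0 \<longleftrightarrow> bm_less (Pt k (-1)) w \<and> bm_less w (Pt k 1)" if "w \<in> bmX" for w
      using that by (cases w) (auto simp: Pt_mem_bmX)
    then have "{w \<in> bmX. code w k = code z k} = {w \<in> bmX. bm_less (Pt k (-1)) w} \<inter> {w \<in> bmX. bm_less w (Pt k 1)}"
      using 3 by (auto simp: code_0_iff)
    then show ?thesis using openin_Int[OF up[OF k[of "-1"]] down[OF k[of 1]]] by simp
  qed
next
  fix U and z :: "'a bm" assume "openin bmTop U" "z \<in> U"
  then have "generate_topology_on (insert bmX ({{z \<in> bmX. bm_less a z} | a. a \<in> bmX} \<union> {{z \<in> bmX. bm_less z a} | a. a \<in> bmX})) U"
    unfolding bmTop_def openin_topology_generated_by_iff by simp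
  then show "\<exists>F. finite F \<and> code_cell bmTop (\<lambda>y z. code z y) F z \<subseteq> U"
    using \<open>z \<in> U\<close>
  proof (induction arbitrary: z)
    case (Int A B)
    then obtain F G where FG: "finite F" "code_cell bmTop (\<lambda>y z. code z y) F z \<subseteq> A"
        "finite G" "code_cell bmTop (\<lambda>y z. code z y) G z \<subseteq> B"
      by (meson IntD1 IntD2)
    then have "code_cell bmTop (\<lambda>y z. code z y) (F \<union> G) z \<subseteq> A \<inter> B"
      by (auto simp: code_cell_def)
    then show ?case using FG by (intro exI[of _ "F \<union> G"]) simp
  next
    case (UN K)
    then obtain k where "k \<in> K" "z \<in> k" by blast
    then show ?case using UN.IH[of k z] by blast
  next
    case (Basis S)
    then consider "S = bmX" | a where "a \<in> bmX" "S = {z \<in> bmX. bm_less a z}"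
      | a where "a \<in> bmX" "S = {z \<in> bmX. bm_less z a}" by blast
    then show ?case
    proof cases
      case 1
      then show ?thesis by (intro exI[of _ "{}"]) (auto simp: code_cell_def topspace_bmTop)
    next
      case 2
      then have z: "z \<in> bmX" "\<not> bm_le z a" using Basis.prems by (auto simp: bm_less_iff_not_le)
      then obtain y where y: "code a y < code z y" using 2(1) by (auto simp: bm_le_iff_code not_le)
      have "bm_less a w" if "w \<in> bmX" "code w y = code z y" for w
        using that y 2(1) unfolding bm_less_iff_not_le[OF 2(1) that(1)] bm_le_iff_code[OF that(1) 2(1)]
        by (metis not_le)
      then show ?thesis using 2(2) by (intro exI[of _ "{y}"]) (auto simp: code_cell_def topspace_bmTop)
    next
      case 3
      then have z: "z \<in> bmX" "\<not> bm_le a z" using Basis.prems by (auto simp: bm_less_iff_not_le)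
      then obtain y where y: "code z y < code a y" using 3(1) by (auto simp: bm_le_iff_code not_le)
      have "bm_less w a" if "w \<in> bmX" "code w y = code z y" for w
        using that y 3(1) unfolding bm_less_iff_not_le[OF that(1) 3(1)] bm_le_iff_code[OF 3(1) that(1)]
        by (metis not_le)
      then show ?thesis using 3(2) by (intro exI[of _ "{y}"]) (auto simp: code_cell_def topspace_bmTop)
    qed
  qed simp
qed

text \<open>A zero of \<open>d\<close> is a point of X. Without zeros, \<open>d\<close> is the sign
  function of a cut: a maximum x of the lower part gives (x,1), a minimum x of the upper part gives
  (x,-1), and if neither exists the cut is a gap. The side copies and gaps are thus exactly the
  limits that X lacks.\<close>

lemma realize_code:
  fixes d :: "'a \<Rightarrow> int"
  assumes range: "\<And>y. d y \<in> {-1, 0, 1}" and strict: "\<And>x y. x < y \<Longrightarrow> d y = -1 \<or> d x = 1"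
  shows "\<exists>z\<in>bmX. \<forall>y. code z y = d y"
proof (cases "\<exists>x. d x = 0")
  case True
  then obtain x where x: "d x = 0" by blast
  have "code (Pt x 0) y = d y" for y
    using strict[of x y] strict[of y x] x by (cases x y rule: linorder_cases) auto
  then show ?thesis by (intro bexI[of _ "Pt x 0"]) (auto simp: Pt_mem_bmX)
next
  case False
  define A where "A = {x. d x = 1}"
  have A: "d y = (if y \<in> A then 1 else -1)" for y
    using range[of y] False unfolding A_def by auto
  have down: "y \<in> A" if "x \<in> A" "y \<le> x" for x y
    using that strict[of y x] unfolding A_def by (cases "y = x") auto
  consider x where "x \<in> A" "\<forall>y\<in>A. y \<le> x" | x where "x \<notin> A" "\<forall>y. y \<notin> A \<longrightarrow> x \<le> y" | "is_gap A"
  proof -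
    have "is_gap A" if "\<not> (\<exists>x\<in>A. \<forall>y\<in>A. y \<le> x)" "\<not> (\<exists>x. x \<notin> A \<and> (\<forall>y. y \<notin> A \<longrightarrow> x \<le> y))"
      unfolding is_gap_def using down that by (auto simp: not_le)
    then show thesis using that by blast
  qed
  then show ?thesis
  proof cases
    case 1
    have "code (Pt x 1) y = d y" for y
    proof (cases "y \<le> x")
      case True
      then show ?thesis using down[OF 1(1)] A[of y] by auto
    next
      case False
      then have "y \<notin> A" using 1(2) by blast
      then show ?thesis using False A[of y] by auto
    qed
    then show ?thesis by (intro bexI[of _ "Pt x 1"]) (auto simp: Pt_mem_bmX)
  next
    case 2
    have "code (Pt x (-1)) y = d y" for y
    proof (cases "x \<le> y")
      case True
      then have "y \<notin> A" using down[of y x] 2(1) by blast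
      then show ?thesis using True A[of y] by auto
    next
      case False
      then have "y \<in> A" using 2(2) by blast
      then show ?thesis using False A[of y] by auto
    qed
    then show ?thesis by (intro bexI[of _ "Pt x (-1)"]) (auto simp: Pt_mem_bmX)
  next
    case 3
    then show ?thesis using A by (intro bexI[of _ "Cut A"]) (auto simp: Cut_mem_bmX)
  qed
qed

lemma compact_space_bmTop: "compact_space (bmTop :: 'a bm topology)"
proof (rule coded_by_compact_space[OF coded_by_bmTop, of "{-1, 0, 1}"])
  fix d :: "'a \<Rightarrow> int"
  assume "\<And>F. finite F \<Longrightarrow> \<exists>z\<in>topspace bmTop. \<forall>k\<in>F. code z k = d k"
  then have fin: "\<exists>z\<in>bmX. \<forall>k\<in>F. code z k = d k" if "finite F" for F
    using that unfolding topspace_bmTop by blast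
  \<comment> \<open>Both conditions of \<open>realize_code\<close> involve at most two test points,
    so they pass from finite approximations to \<open>d\<close>.\<close>
  have "\<exists>z\<in>bmX. \<forall>y. code z y = d y"
  proof (rule realize_code)
    show "d y \<in> {-1, 0, 1}" for y
    proof -
      obtain z where "code z y = d y" using fin[of "{y}"] by auto
      then show ?thesis using code_mem[of z y] by simp
    qed
    show "d y = -1 \<or> d x = 1" if "x < y" for x y
    proof -
      obtain z where "z \<in> bmX" "code z x = d x" "code z y = d y" using fin[of "{x, y}"] by auto
      then show ?thesis using code_strict[of z x y] that by simp
    qed
  qed
  then show "\<exists>z\<in>topspace bmTop. \<forall>k. code z k = d k" unfolding topspace_bmTop .
qed (use code_mem in auto)

lemma Hausdorff_space_bmTop: "Hausdorff_space (bmTop :: 'a bm topology)"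
  by (rule coded_by_Hausdorff_space[OF coded_by_bmTop]) (auto simp: topspace_bmTop intro: code_inject)

end

section \<open>Extending finite partial automorphisms\<close>

context homogeneous_chain
begin

text \<open>\<open>u\<close> is a partial inverse of the wanted automorphism \<open>g\<close>, and
  \<open>w\<close> stands for \<open>inv g y\<close>. By \<open>code_act\<close> the requirement on
  \<open>g\<close> prescribes on which side of each \<open>z\<close> the point \<open>w\<close>
  lies. Either some \<open>f z\<close> equals y and \<open>w\<close> is forced to be
  \<open>z\<close>, or \<open>w\<close> has to separate two finite sets.\<close>

lemma interpolate_point:
  fixes Z :: "'a bm set" and f :: "'a bm \<Rightarrow> 'a bm" and u :: "'a \<Rightarrow> 'a"
  assumes Z: "finite Z" "Z \<subseteq> bmX" "Z \<subseteq> X0 \<union> range Cut" "Cut {} \<in> Z" "Cut UNIV \<in> Z"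
    and f: "\<And>z. z \<in> Z \<Longrightarrow> f z \<in> bmX" "\<And>z w. z \<in> Z \<Longrightarrow> w \<in> Z \<Longrightarrow> bm_le z w \<Longrightarrow> bm_le (f z) (f w)"
      "\<And>z. z \<in> Z \<Longrightarrow> f z \<in> X0 \<Longrightarrow> z \<in> X0"
      "\<And>z w. z \<in> Z \<Longrightarrow> w \<in> Z \<Longrightarrow> f z = f w \<Longrightarrow> f z \<in> X0 \<Longrightarrow> z = w"
      "f (Cut {}) = Cut {}" "f (Cut UNIV) = Cut UNIV"
    and Y: "finite Y"
    and u: "\<And>x y. x \<in> Y \<Longrightarrow> y \<in> Y \<Longrightarrow> x < y \<Longrightarrow> u x < u y"
      "\<And>y z. y \<in> Y \<Longrightarrow> z \<in> Z \<Longrightarrow> code z (u y) = code (f z) y"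
    and y: "y \<notin> Y"
  shows "\<exists>w. (\<forall>x\<in>Y. (x < y \<longrightarrow> u x < w) \<and> (y < x \<longrightarrow> w < u x)) \<and> (\<forall>z\<in>Z. code z w = code (f z) y)"
proof (cases "\<exists>z\<in>Z. f z = Pt y 0")
  case True
  then obtain z where z: "z \<in> Z" "f z = Pt y 0" by blast
  \<comment> \<open>A value in X comes from an argument in X, so \<open>z\<close> is a genuine point
    and can serve as \<open>w\<close>.\<close>
  then have "z \<in> X0" using f(3)[of z] by (auto simp: X0_def)
  then obtain w where w: "z = Pt w 0" by (auto simp: X0_def)
  have "(x < y \<longrightarrow> u x < w) \<and> (y < x \<longrightarrow> w < u x)" if "x \<in> Y" for x
  proof -
    have "code (Pt w 0) (u x) = code (Pt y 0) x" using u(2)[OF that z(1)] z(2) w by simp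
    then show ?thesis by (auto split: if_splits)
  qed
  moreover have "code z' w = code (f z') y" if z': "z' \<in> Z" for z'
  proof (cases "z' = z")
    case True
    then show ?thesis using w z(2) by simp
  next
    case False
    then have ne: "f z' \<noteq> f z" using f(4)[OF z(1) z'] z(2) by (auto simp: X0_def)
    have mem: "z \<in> bmX" "z' \<in> bmX" "f z' \<in> bmX" using Z(2) z z' f(1) by auto
    from bm_le_total[OF mem(1,2)] show ?thesis
    proof
      assume "bm_le z z'"
      then have "code z' w = 1" "code (f z') y = 1"
        using f(2)[OF z(1) z'] ne False w z(2) mem by (auto simp: code_greater_iff)
      then show ?thesis by simp
    next
      assume "bm_le z' z"
      then have "code z' w = -1" "code (f z') y = -1"
        using f(2)[OF z' z(1)] ne False w z(2) mem by (auto simp: code_less_iff)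
      then show ?thesis by simp
    qed
  qed
  ultimately show ?thesis by blast
next
  case False
  \<comment> \<open>\<open>L\<close> collects what must lie below \<open>w\<close>, and
    \<open>R\<close> what must lie above: members of \<open>Z\<close> according to the side of y on
    which their values lie, and the points already chosen. The two ends in \<open>Z\<close> make
    both sets nonempty, as the common bound lemmas demand.\<close>
  define L where "L = {z \<in> Z. code (f z) y = -1} \<union> (\<lambda>x. Pt (u x) 0) ` {x \<in> Y. x < y}"
  define R where "R = {z \<in> Z. code (f z) y = 1} \<union> (\<lambda>x. Pt (u x) 0) ` {x \<in> Y. y < x}"
  have Pt0: "Pt x 0 \<in> bmX" "Pt x 0 \<in> X0" for x :: 'a by (auto simp: Pt_mem_bmX X0_def)
  have "Cut {} \<in> L" "Cut UNIV \<in> R" using Z(4,5) f(5,6) unfolding L_def R_def by simp_all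
  then have ne: "L \<noteq> {}" "R \<noteq> {}" by blast+
  have fin: "finite L" "finite R" using Z(1) Y unfolding L_def R_def by simp_all
  have sub: "L \<subseteq> bmX" "R \<subseteq> bmX" "L \<subseteq> X0 \<union> range Cut" "R \<subseteq> X0 \<union> range Cut"
    using Z(2,3) Pt0 unfolding L_def R_def by blast+
  \<comment> \<open>Two members of \<open>Z\<close> are ordered by monotonicity of \<open>f\<close>.
    A member of \<open>Z\<close> and a chosen point \<open>u x\<close> are ordered by the agreement
    already achieved at x, to which the sign at y is carried by \<open>code_antimono\<close>. Two
    chosen points are ordered by monotonicity of \<open>u\<close>.\<close>
  have sep: "\<not> bm_le b a" if ab: "a \<in> L" "b \<in> R" for a b
  proof -
    have up: "code (f z) x = -1" if "z \<in> Z" "code (f z) y = -1" "y < x" for z x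
      using code_antimono[OF f(1)[OF that(1)], of y x] that(2) less_imp_le[OF that(3)] code_mem[of "f z" x] by auto
    have dn: "code (f z) x = 1" if "z \<in> Z" "code (f z) y = 1" "x < y" for z x
      using code_antimono[OF f(1)[OF that(1)], of x y] that(2) less_imp_le[OF that(3)] code_mem[of "f z" x] by auto
    consider "a \<in> Z" "code (f a) y = -1" "b \<in> Z" "code (f b) y = 1"
      | x where "a \<in> Z" "code (f a) y = -1" "x \<in> Y" "y < x" "b = Pt (u x) 0"
      | x where "x \<in> Y" "x < y" "a = Pt (u x) 0" "b \<in> Z" "code (f b) y = 1"
      | x x' where "x \<in> Y" "x < y" "a = Pt (u x) 0" "x' \<in> Y" "y < x'" "b = Pt (u x') 0"
      using ab unfolding L_def R_def by blast
    then show ?thesis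
    proof cases
      case 1
      show ?thesis
      proof
        assume "bm_le b a"
        then have "bm_le (f b) (f a)" using f(2) 1 by blast
        then have "code (f b) y \<le> code (f a) y" using bm_le_iff_code[OF f(1) f(1)] 1(1,3) by blast
        then show False using 1 by simp
      qed
    next
      case 2
      then have "code a (u x) = -1" using u(2)[of x a] up[of a x] by simp
      then show ?thesis using 2 Z(2) code_less_iff[of a "u x"] bm_le_antisym[of a "Pt (u x) 0"] by auto
    next
      case 3
      then have "code b (u x) = 1" using u(2)[of x b] dn[of b x] by simp
      then show ?thesis using 3 Z(2) code_greater_iff[of b "u x"] bm_le_antisym[of b "Pt (u x) 0"] by auto
    next
      case 4
      then have "u x < u x'" using u(1)[of x x'] by auto
      then show ?thesis using 4 by (auto simp: bm_le_def)
    qed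
  qed
  \<comment> \<open>For a fixed \<open>b\<close> the inner lemma finds a point above all of
    \<open>L\<close> and below \<open>b\<close>; the outer one takes a minimum over
    \<open>b\<close>.\<close>
  have "\<exists>w. (\<forall>a\<in>L. code a w = -1) \<and> (\<forall>b\<in>R. code b w = 1)"
  proof (rule ex_common_below[OF fin(2) ne(2)])
    show "code b v = 1" if "b \<in> R" "code b w = 1" "v \<le> w" for b v w
      using code_antimono[of b v w] that sub(2) code_mem[of b v] by auto
    show "\<exists>w. code b w = 1 \<and> (\<forall>a\<in>L. code a w = -1)" if b: "b \<in> R" for b
    proof (rule ex_common_above[OF fin(1) ne(1)])
      show "code a v = -1" if "a \<in> L" "code a w = -1" "w \<le> v" for a v w
        using code_antimono[of a w v] that sub(1) code_mem[of a v] by auto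
      show "\<exists>w. code a w = -1 \<and> code b w = 1" if "a \<in> L" for a
        using separating_point[of a b] sep[OF that b] that b sub by blast
    qed
  qed
  then obtain w where w: "\<forall>a\<in>L. code a w = -1" "\<forall>b\<in>R. code b w = 1" by blast
  have "(x < y \<longrightarrow> u x < w) \<and> (y < x \<longrightarrow> w < u x)" if "x \<in> Y" for x
  proof -
    have "code (Pt (u x) 0) w = -1" if "x < y"
      using w(1) \<open>x \<in> Y\<close> that unfolding L_def by blast
    moreover have "code (Pt (u x) 0) w = 1" if "y < x"
      using w(2) \<open>x \<in> Y\<close> that unfolding R_def by blast
    ultimately show ?thesis by (auto split: if_splits)
  qed
  moreover have "code z w = code (f z) y" if "z \<in> Z" for z
  proof -
    have "code (f z) y \<noteq> 0" using False that f(1)[OF that] by (auto simp: code_0_iff)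
    then have "z \<in> L \<and> code (f z) y = -1 \<or> z \<in> R \<and> code (f z) y = 1"
      using code_mem[of "f z" y] that unfolding L_def R_def by auto
    then show ?thesis using w by auto
  qed
  ultimately show ?thesis by blast
qed

text \<open>The partial inverse \<open>u\<close> grows over \<open>Y\<close> one point at a time and
  stays strictly increasing. Ultrahomogeneity extends it to an automorphism \<open>p\<close>, and
  the required automorphism is \<open>inv p\<close>.\<close>

lemma interpolate:
  fixes Z :: "'a bm set" and f :: "'a bm \<Rightarrow> 'a bm"
  assumes Z: "finite Z" "Z \<subseteq> bmX" "Z \<subseteq> X0 \<union> range Cut" "Cut {} \<in> Z" "Cut UNIV \<in> Z"
    and f: "\<And>z. z \<in> Z \<Longrightarrow> f z \<in> bmX" "\<And>z w. z \<in> Z \<Longrightarrow> w \<in> Z \<Longrightarrow> bm_le z w \<Longrightarrow> bm_le (f z) (f w)"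
      "\<And>z. z \<in> Z \<Longrightarrow> f z \<in> X0 \<Longrightarrow> z \<in> X0"
      "\<And>z w. z \<in> Z \<Longrightarrow> w \<in> Z \<Longrightarrow> f z = f w \<Longrightarrow> f z \<in> X0 \<Longrightarrow> z = w"
      "f (Cut {}) = Cut {}" "f (Cut UNIV) = Cut UNIV"
    and Y: "finite Y"
  shows "\<exists>g\<in>aut. \<forall>y\<in>Y. \<forall>z\<in>Z. code (act g z) y = code (f z) y"
proof -
  have "\<exists>u. (\<forall>x\<in>Y. \<forall>y\<in>Y. x < y \<longrightarrow> u x < u y) \<and> (\<forall>y\<in>Y. \<forall>z\<in>Z. code z (u y) = code (f z) y)"
    using Y
  proof induction
    case empty
    then show ?case by simp
  next
    case (insert y Y)
    then obtain u where u: "\<forall>x\<in>Y. \<forall>y\<in>Y. x < y \<longrightarrow> u x < u y" "\<forall>y\<in>Y. \<forall>z\<in>Z. code z (u y) = code (f z) y"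
      by blast
    have "\<exists>w. (\<forall>x\<in>Y. (x < y \<longrightarrow> u x < w) \<and> (y < x \<longrightarrow> w < u x)) \<and> (\<forall>z\<in>Z. code z w = code (f z) y)"
      by (rule interpolate_point[OF Z f insert.hyps(1)]) (use u insert.hyps(2) in auto)
    then obtain w where "\<forall>x\<in>Y. (x < y \<longrightarrow> u x < w) \<and> (y < x \<longrightarrow> w < u x)" "\<forall>z\<in>Z. code z w = code (f z) y"
      by blast
    then show ?case using u insert.hyps(2) by (intro exI[of _ "u(y := w)"]) auto
  qed
  then obtain u where u: "\<forall>x\<in>Y. \<forall>y\<in>Y. x < y \<longrightarrow> u x < u y" "\<forall>y\<in>Y. \<forall>z\<in>Z. code z (u y) = code (f z) y"
    by blast
  obtain p where p: "p \<in> aut" "\<forall>y\<in>Y. p y = u y"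
    using extend_finite_strict_mono[OF Y, of u] u(1) by blast
  have "inv (inv p) = p" using aut_bij[OF p(1)] by (rule inv_inv_eq)
  then show ?thesis using u(2) p by (intro bexI[of _ "inv p"]) (auto simp: code_act aut_inv)
qed


text \<open>Near a gap one may replace the extension by the identity, between two of its fixed points
  enclosing the gap.\<close>
lemma extend_fixing_gaps:
  fixes \<phi> :: "'a \<Rightarrow> 'a"
  assumes "finite \<Gamma>" "\<And>A. A \<in> \<Gamma> \<Longrightarrow> is_gap A" "finite D"
    and "\<And>d e. d \<in> D \<Longrightarrow> e \<in> D \<Longrightarrow> d < e \<Longrightarrow> \<phi> d < \<phi> e"
    and "\<And>A d. A \<in> \<Gamma> \<Longrightarrow> d \<in> D \<Longrightarrow> \<phi> d \<in> A \<longleftrightarrow> d \<in> A"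
  shows "\<exists>s\<in>aut. (\<forall>d\<in>D. s d = \<phi> d) \<and> (\<forall>A\<in>\<Gamma>. s ` A = A)"
  using assms
proof (induction \<Gamma> arbitrary: D \<phi> rule: finite_induct)
  case empty
  then show ?case using extend_finite_strict_mono[of D \<phi>] by auto
next
  case (insert A \<Gamma>)
  have A: "is_gap A" and mono: "\<And>d e. d \<in> D \<Longrightarrow> e \<in> D \<Longrightarrow> d < e \<Longrightarrow> \<phi> d < \<phi> e"
    and pres: "\<And>B d. B \<in> insert A \<Gamma> \<Longrightarrow> d \<in> D \<Longrightarrow> \<phi> d \<in> B \<longleftrightarrow> d \<in> B" and D: "finite D"
    using insert.prems by auto
  show ?case
  proof (cases "A = {} \<or> A = UNIV")
    case True
    obtain s where s: "s \<in> aut" "\<forall>d\<in>D. s d = \<phi> d" "\<forall>B\<in>\<Gamma>. s ` B = B"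
      using insert.IH[of D \<phi>] insert.prems by blast
    \<comment> \<open>Improper cuts are invariant under every bijection. They are set apart because
      an enclosing point is missing on one side.\<close>
    moreover have "s ` A = A" using True aut_bij[OF s(1)] by (auto simp: bij_def)
    ultimately show ?thesis by blast
  next
    case False
    \<comment> \<open>Finitely many points of \<open>A\<close> and their images, which stay in
      \<open>A\<close>, have an upper bound there, and \<open>A\<close> has no maximum.\<close>
    obtain a where a: "a \<in> A" "\<forall>d\<in>D \<inter> A. d < a \<and> \<phi> d < a"
    proof -
      define E where "E = (D \<inter> A) \<union> \<phi> ` (D \<inter> A)"
      have E: "finite E" "E \<subseteq> A" using D pres[of A] unfolding E_def by auto
      obtain e where e: "e \<in> A" "\<forall>d\<in>E. d \<le> e"
      proof (cases "E = {}")
        case True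
        then show thesis using False that by auto
      next
        case False
        then have "Max E \<in> A" using E Max_in by blast
        then show thesis using that[of "Max E"] E(1) by simp
      qed
      obtain a where "a \<in> A" "e < a" using is_gap_ex_above[OF A e(1)] by blast
      then have "\<forall>d\<in>E. d < a" using e(2) by (meson le_less_trans)
      then show thesis using that[of a] \<open>a \<in> A\<close> unfolding E_def by simp
    qed
    obtain b where b: "b \<notin> A" "\<forall>d\<in>D - A. b < d \<and> b < \<phi> d"
    proof -
      define E where "E = (D - A) \<union> \<phi> ` (D - A)"
      have E: "finite E" "E \<inter> A = {}" using D pres[of A] unfolding E_def by auto
      obtain e where e: "e \<notin> A" "\<forall>d\<in>E. e \<le> d"
      proof (cases "E = {}")
        case True
        then show thesis using False that by auto
      next
        case False
        then have "Min E \<notin> A" using E Min_in by blast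
        then show thesis using that[of "Min E"] E(1) by simp
      qed
      obtain b where "b \<notin> A" "b < e" using is_gap_ex_below[OF A e(1)] by blast
      then have "\<forall>d\<in>E. b < d" using e(2) by (meson less_le_trans)
      then show thesis using that[of b] \<open>b \<notin> A\<close> unfolding E_def by simp
    qed
    have ab: "a < b" using is_gap_downward[OF A a(1), of b] b(1) by (meson not_le)
    \<comment> \<open>The enclosing points become two further fixed points. This keeps the map
      increasing and preserves the remaining cuts, so the induction hypothesis for
      \<open>\<Gamma>\<close> applies.\<close>
    define \<phi>' where "\<phi>' d = (if d = a \<or> d = b then d else \<phi> d)" for d
    have in_or: "(d \<in> A \<and> d < a \<and> \<phi> d < a) \<or> (d \<notin> A \<and> b < d \<and> b < \<phi> d)" if "d \<in> D" for d
      using a b that by (cases "d \<in> A") auto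
    have D': "a \<notin> D" "b \<notin> D" using in_or a(1) b(1) by auto
    have "\<exists>s\<in>aut. (\<forall>d\<in>insert a (insert b D). s d = \<phi>' d) \<and> (\<forall>B\<in>\<Gamma>. s ` B = B)"
    proof (rule insert.IH)
      show "\<phi>' d < \<phi>' e" if "d \<in> insert a (insert b D)" "e \<in> insert a (insert b D)" "d < e" for d e
        using that(1,2)
      proof (elim insertE)
        assume "d \<in> D" "e \<in> D"
        then show ?thesis using mono[of d e] that(3) D' unfolding \<phi>'_def by auto
      next
        assume "d = a" "e \<in> D"
        then show ?thesis using in_or[of e] that(3) D' ab unfolding \<phi>'_def by auto
      next
        assume "d = b" "e \<in> D"
        then show ?thesis using in_or[of e] that(3) D' ab unfolding \<phi>'_def by auto
      next
        assume "d \<in> D" "e = a"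
        then show ?thesis using in_or[of d] that(3) D' ab unfolding \<phi>'_def by auto
      next
        assume "d \<in> D" "e = b"
        then show ?thesis using in_or[of d] that(3) D' ab unfolding \<phi>'_def by auto
      qed (use that(3) in \<open>auto simp: \<phi>'_def\<close>)
      show "\<phi>' d \<in> B \<longleftrightarrow> d \<in> B" if "B \<in> \<Gamma>" "d \<in> insert a (insert b D)" for B d
        using that pres[of B d] unfolding \<phi>'_def by auto
    qed (use D insert.prems(1) in auto)
    then obtain s where s: "s \<in> aut" "\<forall>d\<in>insert a (insert b D). s d = \<phi>' d" "\<forall>B\<in>\<Gamma>. s ` B = B"
      by blast
    have sab: "s a = a" "s b = b" using s(2) unfolding \<phi>'_def by auto
    have s_a: "s x < a \<longleftrightarrow> x < a" and s_b: "b < s x \<longleftrightarrow> b < x" for x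
      using aut_less_iff[OF s(1), of x a] aut_less_iff[OF s(1), of b x] sab by auto
    \<comment> \<open>As \<open>s\<close> fixes \<open>a\<close> and \<open>b\<close>, gluing with
      the identity stays increasing and onto. Both pieces respect each cut in
      \<open>\<Gamma>\<close>; the cut \<open>A\<close> lies between \<open>a\<close> and
      \<open>b\<close>, and points outside this interval stay on their side.\<close>
    define r where "r x = (if a \<le> x \<and> x \<le> b then x else s x)" for x
    have r_cases: "x < a \<and> r x = s x \<and> r x < a \<or> a \<le> x \<and> x \<le> b \<and> r x = x \<or> b < x \<and> r x = s x \<and> b < r x" for x
      using s_a[of x] s_b[of x] unfolding r_def by auto
    have r: "r \<in> aut"
    proof (rule autI)
      show "r x < r y" if "x < y" for x y
        using r_cases[of x] r_cases[of y] that aut_less_iff[OF s(1), of x y] ab by auto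
      show "surj r"
      proof (rule surjI)
        fix y
        show "r (if a \<le> y \<and> y \<le> b then y else inv s y) = y"
          using s_a[of "inv s y"] s_b[of "inv s y"] s(1) unfolding r_def by (auto simp: not_le)
      qed
    qed
    have "r d = \<phi> d" if "d \<in> D" for d
      using in_or[OF that] s(2) that D' ab unfolding r_def \<phi>'_def by auto
    moreover have "r ` B = B" if "B \<in> \<Gamma>" for B
      using s(3) that unfolding aut_image_eq_iff[OF r] r_def by (auto simp: aut_image_eq_iff[OF s(1)])
    moreover have "r ` A = A"
      unfolding aut_image_eq_iff[OF r]
    proof
      fix x
      have "x < a \<Longrightarrow> x \<in> A" "b < x \<Longrightarrow> x \<notin> A" for x
        using is_gap_downward[OF A a(1), of x] is_gap_downward[OF A, of x b] b(1) less_imp_le by metis+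
      then show "r x \<in> A \<longleftrightarrow> x \<in> A" using r_cases[of x] by auto
    qed
    ultimately show ?thesis using r by blast
  qed
qed

section \<open>Double cosets of pointwise stabilizers\<close>

definition pts :: "'a set \<Rightarrow> 'a bm set" where
  "pts Y = (\<lambda>y. Pt y 0) ` Y"

lemma stab_pts: "stab (pts Y) = {h \<in> aut. \<forall>y\<in>Y. h y = y}"
  by (auto simp: stab_def pts_def)

text \<open>In a factorization h = n g s the factor n is determined by s, and it fixes y exactly
  when s sends \<open>inv h y\<close> to \<open>inv g y\<close>. Only \<open>s\<close> in
  \<open>stab Z\<close> has to be constructed, from its values on the finite set
  \<open>D\<close>.\<close>

lemma double_coset:
  fixes Z :: "'a bm set" and Y :: "'a set"
  assumes gh: "g \<in> aut" "h \<in> aut" and Z: "finite Z" "Z \<subseteq> bmX" "Z \<subseteq> X0 \<union> range Cut" and Y: "finite Y"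
    and agree: "\<And>z y. z \<in> Z \<Longrightarrow> y \<in> Y \<Longrightarrow> code (act g z) y = code (act h z) y"
  shows "h \<in> triple_prod (stab (pts Y)) g (stab Z)"
proof -
  define K where "K = {x. Pt x 0 \<in> Z}"
  define D where "D = inv h ` Y \<union> K"
  define \<phi> where "\<phi> d = (if d \<in> K then d else inv g (h d))" for d
  have K: "finite K" unfolding K_def
    by (rule finite_imageD[of "\<lambda>x. Pt x 0"]) (auto intro: finite_subset[OF _ Z(1)] inj_onI)
  have ag: "code z (inv g y) = code z (inv h y)" if "z \<in> Z" "y \<in> Y" for z y
    using agree[OF that] gh by (simp add: code_act)
  have agK: "(x < inv g y \<longleftrightarrow> x < inv h y) \<and> (inv g y < x \<longleftrightarrow> inv h y < x)" if "x \<in> K" "y \<in> Y" for x y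
    using ag[of "Pt x 0" y] that unfolding K_def by (auto split: if_splits)
  \<comment> \<open>The two prescriptions for \<open>\<phi>\<close> are compatible: if
    \<open>inv h y\<close> is a point x of \<open>Z\<close>, then agreement of codes forbids
    \<open>inv g y\<close> to lie on either side of x.\<close>
  have \<phi>Y: "\<phi> (inv h y) = inv g y" if "y \<in> Y" for y
  proof (cases "inv h y \<in> K")
    case True
    then show ?thesis using agK[OF True that] unfolding \<phi>_def by (metis linorder_neqE less_irrefl)
  next
    case False
    then show ?thesis using gh unfolding \<phi>_def by simp
  qed
  have \<phi>K: "\<phi> x = x" if "x \<in> K" for x using that unfolding \<phi>_def by simp
  have "\<exists>s\<in>aut. (\<forall>d\<in>D. s d = \<phi> d) \<and> (\<forall>A\<in>{A. Cut A \<in> Z}. s ` A = A)"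
  proof (rule extend_fixing_gaps)
    show "finite {A. Cut A \<in> Z}"
      by (rule finite_imageD[of Cut]) (auto intro: finite_subset[OF _ Z(1)] inj_onI)
    show "is_gap A" if "A \<in> {A. Cut A \<in> Z}" for A using that Z(2) Cut_mem_bmX by auto
    show "finite D" unfolding D_def using K Y by simp
    show "\<phi> d < \<phi> e" if "d \<in> D" "e \<in> D" "d < e" for d e
      using that(1,2) unfolding D_def
    proof (elim UnE imageE)
      fix y y' assume "d = inv h y" "y \<in> Y" "e = inv h y'" "y' \<in> Y"
      then show ?thesis using that(3) \<phi>Y aut_less_iff[OF aut_inv[OF gh(1)]] aut_less_iff[OF aut_inv[OF gh(2)]]
        by simp
    next
      fix y assume "d = inv h y" "y \<in> Y" "e \<in> K"
      then show ?thesis using that(3) \<phi>Y \<phi>K agK[of e y] by simp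
    next
      fix y assume "e = inv h y" "y \<in> Y" "d \<in> K"
      then show ?thesis using that(3) \<phi>Y \<phi>K agK[of d y] by simp
    next
      assume "d \<in> K" "e \<in> K"
      then show ?thesis using that(3) \<phi>K by simp
    qed
    show "\<phi> d \<in> A \<longleftrightarrow> d \<in> A" if "A \<in> {A. Cut A \<in> Z}" "d \<in> D" for A d
      using that(2) unfolding D_def
    proof (elim UnE imageE)
      fix y assume "d = inv h y" "y \<in> Y"
      then show ?thesis using ag[of "Cut A" y] that(1) \<phi>Y by (auto split: if_splits)
    next
      assume "d \<in> K"
      then show ?thesis using \<phi>K[of d] by simp
    qed
  qed
  then obtain s where s: "s \<in> aut" "\<forall>d\<in>D. s d = \<phi> d" "\<forall>A\<in>{A. Cut A \<in> Z}. s ` A = A"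
    by (elim bexE conjE)
  have sZ: "s \<in> stab Z"
    unfolding stab_def
  proof (intro CollectI conjI ballI)
    fix z assume z: "z \<in> Z"
    then consider x where "z = Pt x 0" | A where "z = Cut A" using Z(3) unfolding X0_def by blast
    then show "act s z = z"
    proof cases
      case 1
      then have "x \<in> K" using z unfolding K_def by simp
      then show ?thesis using 1 s(2) \<phi>K unfolding D_def by simp
    qed (use s(3) z in simp)
  qed (rule s(1))
  define n where "n = h \<circ> inv s \<circ> inv g"
  have n: "n \<in> aut" unfolding n_def using gh s(1) by (intro aut_comp aut_inv)
  have "n y = y" if "y \<in> Y" for y
  proof -
    have "s (inv h y) = inv g y" using s(2) that \<phi>Y unfolding D_def by simp
    then have "inv s (inv g y) = inv h y" using s(1) by (metis aut_inv_left)
    then show ?thesis unfolding n_def using gh(2) by simp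
  qed
  then have "n \<in> stab (pts Y)" using n by (simp add: stab_pts)
  moreover have "h = n \<circ> g \<circ> s" unfolding n_def using gh s(1) by (auto simp: fun_eq_iff)
  ultimately show ?thesis unfolding triple_prod_def using sZ by blast
qed

end

section \<open>Completions of the automorphism group\<close>

text \<open>Fixing x amounts to fixing any of its three copies, so passing to the middle copy
  retains stabilizers and leads to points and gaps, where separation by points of X is
  available.\<close>

fun base :: "'a bm \<Rightarrow> 'a bm" where
  "base (Pt x j) = Pt x 0"
| "base (Cut A) = Cut A"

lemma act_comp: "act (g \<circ> h) z = act g (act h z)"
  by (cases z) (auto simp: image_comp)

lemma act_id: "act id z = z"
  by (cases z) auto

lemma stab_base: "stab (base ` \<sigma>) \<subseteq> stab \<sigma>"
proof
  fix s assume s: "s \<in> stab (base ` \<sigma>)"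
  then have "act s z = z" if "z \<in> \<sigma>" for z
    using that by (cases z) (force simp: stab_def)+
  then show "s \<in> stab \<sigma>" using s by (simp add: stab_def)
qed

lemma triple_prod_mono: "N \<subseteq> N' \<Longrightarrow> S \<subseteq> S' \<Longrightarrow> triple_prod N g S \<subseteq> triple_prod N' g S'"
  by (auto simp: triple_prod_def)

lemma id_mem_stab: "id \<in> stab \<sigma>"
  by (simp add: stab_def aut_id act_id)

lemma mem_triple_prod_self: "id \<in> N \<Longrightarrow> id \<in> S \<Longrightarrow> g \<in> triple_prod N g S"
  unfolding triple_prod_def by (intro CollectI exI[of _ id]) simp

section \<open>The two uniformities on the group in terms of codes\<close>

context homogeneous_chain
begin

lemma base_mem: "z \<in> bmX \<Longrightarrow> base z \<in> bmX \<and> base (z :: 'a bm) \<in> X0 \<union> range Cut"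
  by (cases z) (auto simp: Pt_mem_bmX X0_def)

lemma finite_pts: "finite Y \<Longrightarrow> finite (pts Y)" and pts_subset: "pts Y \<subseteq> bmX" "pts Y \<subseteq> X0"
  by (auto simp: pts_def Pt_mem_bmX X0_def)

lemma nbhd_id_iff: "nbhd_id N \<longleftrightarrow> N \<subseteq> aut \<and> (\<exists>Y. finite Y \<and> stab (pts Y) \<subseteq> (N :: ('a \<Rightarrow> 'a) set))"
proof -
  let ?c = "\<lambda>(i, k::unit) f :: 'a \<Rightarrow> 'a. id (f i)"
  have cod: "coded_by Gtop ?c"
    unfolding Gtop_def by (rule coded_by_subtopology[OF coded_by_product_topology[OF coded_by_discrete]])
  have top: "topspace Gtop = (aut :: ('a \<Rightarrow> 'a) set)" by (simp add: Gtop_def)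
  have cell: "code_cell Gtop ?c F id = stab (pts (fst ` F))" for F
    unfolding code_cell_def top stab_pts by auto
  show ?thesis
  proof
    assume "nbhd_id N"
    then obtain U where U: "N \<subseteq> aut" "openin Gtop U" "id \<in> U" "U \<subseteq> N" unfolding nbhd_id_def by blast
    then obtain F where "finite F" "code_cell Gtop ?c F id \<subseteq> U"
      using coded_by_open_contains_cell[OF cod] by blast
    then show "N \<subseteq> aut \<and> (\<exists>Y. finite Y \<and> stab (pts Y) \<subseteq> N)"
      using U unfolding cell by (intro conjI exI[of _ "fst ` F"]) auto
  next
    assume "N \<subseteq> aut \<and> (\<exists>Y. finite Y \<and> stab (pts Y) \<subseteq> N)"
    then obtain Y where Y: "N \<subseteq> aut" "finite Y" "stab (pts Y) \<subseteq> N" by blast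
    have fst: "fst ` (Y \<times> (UNIV :: unit set)) = Y" by simp
    have "openin Gtop (stab (pts Y))"
      using openin_code_cell[OF cod, of "Y \<times> UNIV" id] Y(2) unfolding cell fst by simp
    then show "nbhd_id N" unfolding nbhd_id_def using Y id_mem_stab by blast
  qed
qed

lemma nbhd_id_stab: "finite Y \<Longrightarrow> nbhd_id (stab (pts (Y :: 'a set)))"
  unfolding nbhd_id_iff by (auto simp: stab_def)

text \<open>This is the converse of \<open>double_coset\<close>: the right factor leaves
  \<open>z\<close> in place, and the left factor translates the code by its inverse, which fixes
  y.\<close>

lemma code_triple_prod:
  fixes g :: "'a \<Rightarrow> 'a"
  assumes "h \<in> triple_prod (stab (pts Y)) g (stab \<sigma>)" "g \<in> aut"
  shows "h \<in> aut" "z \<in> \<sigma> \<Longrightarrow> y \<in> Y \<Longrightarrow> code (act h z) y = code (act g z) y"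
proof -
  obtain n s where h: "h = n \<circ> g \<circ> s" and n: "n \<in> aut" "\<forall>y\<in>Y. n y = y"
      and s: "s \<in> aut" "\<forall>z\<in>\<sigma>. act s z = z"
    using assms(1) unfolding triple_prod_def stab_pts by (auto simp: stab_def)
  show "h \<in> aut" unfolding h using n(1) s(1) assms(2) by (intro aut_comp)
  assume z: "z \<in> \<sigma>" and y: "y \<in> Y"
  have "inv n y = y" using aut_inv_left[OF n(1), of y] n(2) y by simp
  then show "code (act h z) y = code (act g z) y"
    unfolding h act_comp using s(2) z code_act[OF n(1)] by simp
qed

text \<open>By \<open>double_coset\<close>, agreement on finitely many coordinates puts h into the
  member of the cover indexed by g, which contains g as well; side copies in \<open>\<sigma>\<close>
  are first replaced by their base points. The reverse inclusion is
  \<open>code_triple_prod\<close>.\<close>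

lemma R_Sigma_bm_coded:
  "(R_Sigma_bm :: (('a \<Rightarrow> 'a) \<times> ('a \<Rightarrow> 'a)) set set) = code_unif aut (\<lambda>(z, y) g. code (iota_m g z) y)"
proof (intro equalityI subsetI)
  fix E :: "(('a \<Rightarrow> 'a) \<times> ('a \<Rightarrow> 'a)) set" assume "E \<in> R_Sigma_bm"
  then obtain N \<sigma> where E: "E \<subseteq> aut \<times> aut" "nbhd_id N" "finite \<sigma>" "\<sigma> \<subseteq> bmX"
      "cover_ent {triple_prod N g (stab \<sigma>) | g. g \<in> aut} \<subseteq> E"
    unfolding R_Sigma_bm_def by blast
  obtain Y where Y: "finite Y" "stab (pts Y) \<subseteq> N" using E(2) unfolding nbhd_id_iff by blast
  have Z: "finite (base ` \<sigma>)" "base ` \<sigma> \<subseteq> bmX" "base ` \<sigma> \<subseteq> X0 \<union> range Cut"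
    using E(3,4) base_mem by auto
  let ?F = "base ` \<sigma> \<times> Y"
  have "(g, h) \<in> E" if gh: "g \<in> aut" "h \<in> aut"
    and ag: "\<And>z y. z \<in> base ` \<sigma> \<Longrightarrow> y \<in> Y \<Longrightarrow> code (iota_m g z) y = code (iota_m h z) y" for g h
  proof -
    have "h \<in> triple_prod (stab (pts Y)) g (stab (base ` \<sigma>))"
    proof (rule double_coset[OF gh Z Y(1)])
      fix z y assume zy: "z \<in> base ` \<sigma>" "y \<in> Y"
      then have "z \<in> bmX" using Z(2) by blast
      then show "code (act g z) y = code (act h z) y" using ag[OF zy] by (simp add: iota_m_def)
    qed
    then have "h \<in> triple_prod N g (stab \<sigma>)" using triple_prod_mono[OF Y(2) stab_base] by blast
    moreover have "g \<in> triple_prod N g (stab \<sigma>)"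
      by (rule mem_triple_prod_self) (use Y(2) id_mem_stab in auto)
    ultimately have "(g, h) \<in> cover_ent {triple_prod N g (stab \<sigma>) | g. g \<in> aut}"
      unfolding cover_ent_def using gh by blast
    then show ?thesis using E(5) by blast
  qed
  then have "{(g, h). g \<in> aut \<and> h \<in> aut \<and> (\<forall>k\<in>?F. (case k of (z, y) \<Rightarrow> \<lambda>g. code (iota_m g z) y) g
      = (case k of (z, y) \<Rightarrow> \<lambda>g. code (iota_m g z) y) h)} \<subseteq> E" by auto
  then show "E \<in> code_unif aut (\<lambda>(z, y) g. code (iota_m g z) y)"
    unfolding code_unif_def using E(1) Z(1) Y(1) by (intro CollectI conjI exI[of _ ?F]) auto
next
  fix E :: "(('a \<Rightarrow> 'a) \<times> ('a \<Rightarrow> 'a)) set" assume "E \<in> code_unif aut (\<lambda>(z, y) g. code (iota_m g z) y)"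
  then obtain F where E: "E \<subseteq> aut \<times> aut" "finite F" "{(g, h). g \<in> aut \<and> h \<in> aut \<and>
      (\<forall>k\<in>F. (case k of (z, y) \<Rightarrow> \<lambda>g. code (iota_m g z) y) g
        = (case k of (z, y) \<Rightarrow> \<lambda>g. code (iota_m g z) y) h)} \<subseteq> E"
    unfolding code_unif_def by auto
  \<comment> \<open>Coordinates outside \<open>bmX\<close> are dropped from
    \<open>?\<sigma>\<close>: there \<open>iota_m g\<close> is \<open>undefined\<close> for every g,
    so agreement is automatic.\<close>
  let ?N = "stab (pts (snd ` F))" and ?\<sigma> = "fst ` F \<inter> bmX"
  have "cover_ent {triple_prod ?N g (stab ?\<sigma>) | g. g \<in> aut} \<subseteq> E"
  proof
    fix p assume "p \<in> cover_ent {triple_prod ?N g (stab ?\<sigma>) | g. g \<in> aut}"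
    then obtain k h h' where p: "p = (h, h')" and k: "k \<in> aut" and h: "h \<in> triple_prod ?N k (stab ?\<sigma>)"
        and h': "h' \<in> triple_prod ?N k (stab ?\<sigma>)"
      unfolding cover_ent_def by blast
    have "code (iota_m h z) y = code (iota_m h' z) y" if "(z, y) \<in> F" for z y
    proof (cases "z \<in> bmX")
      case True
      have "z \<in> ?\<sigma>" "y \<in> snd ` F" using that True by force+
      then show ?thesis using code_triple_prod(2)[OF h k] code_triple_prod(2)[OF h' k] True
        by (simp add: iota_m_def)
    qed (simp add: iota_m_def)
    then show "p \<in> E" using E(3) p code_triple_prod(1)[OF h k] code_triple_prod(1)[OF h' k] by auto
  qed
  then show "E \<in> R_Sigma_bm"
    unfolding R_Sigma_bm_def using E(1,2) nbhd_id_stab[of "snd ` F"]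
    by (intro CollectI conjI exI[of _ ?N] exI[of _ ?\<sigma>]) auto
qed

lemma Roelcke_double_coset:
  fixes Y :: "'a set"
  assumes gh: "g \<in> aut" "h \<in> aut" and Y: "finite Y" "stab (pts Y) \<subseteq> N"
    and ag: "\<And>x y. x \<in> Y \<Longrightarrow> y \<in> Y \<Longrightarrow> code (j_d g x) y = code (j_d h x) y"
  shows "h \<in> triple_prod N g N"
proof -
  have "h \<in> triple_prod (stab (pts Y)) g (stab (pts Y))"
    by (rule double_coset[OF gh finite_pts[OF Y(1)] pts_subset(1) _ Y(1)])
      (use pts_subset(2) ag in \<open>auto simp: pts_def j_d_def\<close>)
  then show ?thesis using triple_prod_mono[OF Y(2) Y(2)] by blast
qed

lemma roelcke_coded:
  "(roelcke :: (('a \<Rightarrow> 'a) \<times> ('a \<Rightarrow> 'a)) set set) = code_unif aut (\<lambda>(x, y) g. code (j_d g x) y)"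
proof (intro equalityI subsetI)
  fix E :: "(('a \<Rightarrow> 'a) \<times> ('a \<Rightarrow> 'a)) set" assume "E \<in> roelcke"
  then obtain N where E: "E \<subseteq> aut \<times> aut" "nbhd_id N"
      "cover_ent {triple_prod N g N | g. g \<in> aut} \<subseteq> E"
    unfolding roelcke_def by blast
  obtain Y where Y: "finite Y" "stab (pts Y) \<subseteq> N" using E(2) unfolding nbhd_id_iff by blast
  let ?F = "Y \<times> Y"
  have "(g, h) \<in> E" if gh: "g \<in> aut" "h \<in> aut"
    and ag: "\<And>x y. x \<in> Y \<Longrightarrow> y \<in> Y \<Longrightarrow> code (j_d g x) y = code (j_d h x) y" for g h
  proof -
    have "h \<in> triple_prod N g N" by (rule Roelcke_double_coset[OF gh Y ag])
    moreover have "g \<in> triple_prod N g N"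
      by (rule mem_triple_prod_self) (use Y(2) id_mem_stab in auto)
    ultimately have "(g, h) \<in> cover_ent {triple_prod N g N | g. g \<in> aut}"
      unfolding cover_ent_def using gh by blast
    then show ?thesis using E(3) by blast
  qed
  then have "{(g, h). g \<in> aut \<and> h \<in> aut \<and> (\<forall>k\<in>?F. (case k of (z, y) \<Rightarrow> \<lambda>g. code (j_d g z) y) g
      = (case k of (z, y) \<Rightarrow> \<lambda>g. code (j_d g z) y) h)} \<subseteq> E" by auto
  then show "E \<in> code_unif aut (\<lambda>(x, y) g. code (j_d g x) y)"
    unfolding code_unif_def using E(1) Y(1) by (intro CollectI conjI exI[of _ ?F]) auto
next
  fix E :: "(('a \<Rightarrow> 'a) \<times> ('a \<Rightarrow> 'a)) set" assume "E \<in> code_unif aut (\<lambda>(x, y) g. code (j_d g x) y)"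
  then obtain F where E: "E \<subseteq> aut \<times> aut" "finite F" "{(g, h). g \<in> aut \<and> h \<in> aut \<and>
      (\<forall>k\<in>F. (case k of (z, y) \<Rightarrow> \<lambda>g. code (j_d g z) y) g
        = (case k of (z, y) \<Rightarrow> \<lambda>g. code (j_d g z) y) h)} \<subseteq> E"
    unfolding code_unif_def by auto
  \<comment> \<open>One neighbourhood acts on both sides here, so arguments and test points have to
    be collected into a single set.\<close>
  let ?Y = "fst ` F \<union> snd ` F"
  let ?N = "stab (pts ?Y)"
  have "cover_ent {triple_prod ?N g ?N | g. g \<in> aut} \<subseteq> E"
  proof
    fix p assume "p \<in> cover_ent {triple_prod ?N g ?N | g. g \<in> aut}"
    then obtain k h h' where p: "p = (h, h')" and k: "k \<in> aut" and h: "h \<in> triple_prod ?N k ?N"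
        and h': "h' \<in> triple_prod ?N k ?N"
      unfolding cover_ent_def by blast
    have "code (j_d h x) y = code (j_d h' x) y" if "(x, y) \<in> F" for x y
    proof -
      have "Pt x 0 \<in> pts ?Y" "y \<in> ?Y" using that unfolding pts_def by force+
      then show ?thesis
        using code_triple_prod(2)[OF h k, of "Pt x 0" y] code_triple_prod(2)[OF h' k, of "Pt x 0" y]
        by (simp add: j_d_def)
    qed
    then show "p \<in> E" using E(3) p code_triple_prod(1)[OF h k] code_triple_prod(1)[OF h' k] by auto
  qed
  then show "E \<in> roelcke"
    unfolding roelcke_def using E(1,2) nbhd_id_stab[of ?Y]
    by (intro CollectI conjI exI[of _ ?N]) auto
qed

text \<open>For a stabilizer of a finite \<open>Y\<close>, the double coset of g is determined by
  the signs of g x relative to y for x, y in \<open>Y\<close>, so there are at most 3^(|Y|^2) of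
  them.\<close>

lemma Roelcke_precompact: "roelcke_precompact TYPE('a)"
  unfolding roelcke_precompact_def
proof (intro allI impI)
  fix N :: "('a \<Rightarrow> 'a) set" assume "nbhd_id N"
  then obtain Y where Y: "finite Y" "stab (pts Y) \<subseteq> N" unfolding nbhd_id_iff by blast
  define P where "P g = restrict (\<lambda>(x, y). code (j_d g x) y) (Y \<times> Y)" for g :: "'a \<Rightarrow> 'a"
  have "P ` aut \<subseteq> (\<Pi>\<^sub>E k\<in>Y \<times> Y. {-1, 0, 1})"
  proof (rule image_subsetI)
    fix g :: "'a \<Rightarrow> 'a"
    have "(\<lambda>(x, y). code (j_d g x) y) \<in> (\<Pi> k\<in>Y \<times> Y. {-1, 0, 1})"
    proof
      fix k show "(case k of (x, y) \<Rightarrow> code (j_d g x) y) \<in> {-1, 0, 1}"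
        using code_mem[of "j_d g (fst k)" "snd k"] by (cases k) simp
    qed
    then show "P g \<in> (\<Pi>\<^sub>E k\<in>Y \<times> Y. {-1, 0, 1})" unfolding P_def by (simp only: restrict_PiE_iff Pi_iff)
  qed
  moreover have "finite (\<Pi>\<^sub>E k\<in>Y \<times> Y. {-1, 0, 1 :: int})" using Y(1) by (intro finite_PiE) auto
  ultimately have "finite (P ` aut)" by (rule finite_subset)
  then obtain C where C: "C \<subseteq> aut" "finite C" "P ` aut = P ` C"
    using finite_subset_image[of "P ` aut" P aut] by blast
  have "h \<in> (\<Union>g\<in>C. triple_prod N g N)" if h: "h \<in> aut" for h
  proof -
    have "P h \<in> P ` C" using h C(3) by blast
    then obtain g where g: "g \<in> C" "P h = P g" by blast
    have "code (j_d g x) y = code (j_d h x) y" if "x \<in> Y" "y \<in> Y" for x y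
      using fun_cong[OF g(2), of "(x, y)"] that unfolding P_def by simp
    then have "h \<in> triple_prod N g N" using Roelcke_double_coset[OF _ h Y] g(1) C(1) by blast
    then show ?thesis using g(1) by blast
  qed
  then show "\<exists>F. finite F \<and> F \<subseteq> aut \<and> aut \<subseteq> (\<Union>g\<in>F. triple_prod N g N)" using C by blast
qed

text \<open>The only gaps are the two ends, which every automorphism fixes, so their coordinates are
  constant. The code of (g x, j) at y depends only on j and on the code of (g x, 0) at y.\<close>

lemma continuously_ordered_R_Sigma_eq_roelcke:
  assumes "continuously_ordered TYPE('a)"
  shows "(R_Sigma_bm :: (('a \<Rightarrow> 'a) \<times> ('a \<Rightarrow> 'a)) set set) = roelcke"
  unfolding R_Sigma_bm_coded roelcke_coded
proof (rule equalityI; rule code_unif_mono)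
  fix k :: "'a bm \<times> 'a"
  obtain z y where k: "k = (z, y)" by force
  show "\<exists>F. finite F \<and> (\<forall>g\<in>aut. \<forall>h\<in>aut.
      (\<forall>i\<in>F. (case i of (x, y) \<Rightarrow> \<lambda>g. code (j_d g x) y) g = (case i of (x, y) \<Rightarrow> \<lambda>g. code (j_d g x) y) h) \<longrightarrow>
      (case k of (z, y) \<Rightarrow> \<lambda>g. code (iota_m g z) y) g = (case k of (z, y) \<Rightarrow> \<lambda>g. code (iota_m g z) y) h)"
  proof (cases z)
    case (Pt x j)
    then show ?thesis unfolding k
      by (intro exI[of _ "{(x, y)}"]) (auto simp: iota_m_def j_d_def split: if_splits)
  next
    case (Cut A)
    have const: "code (iota_m g z) y = code (iota_m h z) y" if "g \<in> aut" "h \<in> aut" for g h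
    proof (cases "z \<in> bmX")
      case True
      then have "A = {} \<or> A = UNIV"
        using assms unfolding continuously_ordered_def Cut Cut_mem_bmX by blast
      then show ?thesis using that True Cut by (auto simp: iota_m_def aut_image_mem)
    qed (simp add: iota_m_def)
    show ?thesis
    proof (intro exI[of _ "{}"] conjI ballI impI)
      fix g h :: "'a \<Rightarrow> 'a" assume "g \<in> aut" "h \<in> aut"
      then show "(case k of (z, y) \<Rightarrow> \<lambda>g. code (iota_m g z) y) g = (case k of (z, y) \<Rightarrow> \<lambda>g. code (iota_m g z) y) h"
        using const[of g h] k by simp
    qed simp
  qed
next
  fix k :: "'a \<times> 'a"
  obtain x y where k: "k = (x, y)" by force
  show "\<exists>F. finite F \<and> (\<forall>g\<in>aut. \<forall>h\<in>aut.
      (\<forall>i\<in>F. (case i of (z, y) \<Rightarrow> \<lambda>g. code (iota_m g z) y) g = (case i of (z, y) \<Rightarrow> \<lambda>g. code (iota_m g z) y) h) \<longrightarrow>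
      (case k of (x, y) \<Rightarrow> \<lambda>g. code (j_d g x) y) g = (case k of (x, y) \<Rightarrow> \<lambda>g. code (j_d g x) y) h)"
    unfolding k by (intro exI[of _ "{(Pt x 0, y)}"]) (auto simp: iota_m_def j_d_def Pt_mem_bmX)
qed

end

definition ellis_model :: "('a::linorder bm \<Rightarrow> 'a bm) set" where
  "ellis_model = {f \<in> (\<Pi>\<^sub>E z\<in>bmX. bmX).
     (\<forall>x\<in>bmX. \<forall>y\<in>bmX. bm_le x y \<longrightarrow> bm_le (f x) (f y))
   \<and> (\<forall>x\<in>bmX - X0. f x \<notin> X0)
   \<and> (\<forall>x\<in>bmX. \<forall>y\<in>bmX. f x = f y \<and> x \<noteq> y \<longrightarrow> f x \<in> bmX - X0)
   \<and> (\<forall>x::'a. (f (Pt x (-1)) = f (Pt x 0) \<and> f (Pt x 0) = f (Pt x 1) \<and> f (Pt x 0) \<notin> X0)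
             \<or> (\<exists>y. \<forall>j\<in>{-1, 0, 1}. f (Pt x j) = Pt y j))
   \<and> f (Cut {}) = Cut {} \<and> f (Cut UNIV) = Cut UNIV}"

section \<open>The closures of the group in the two spaces of maps\<close>

context homogeneous_chain
begin

lemma iota_m_mem: "g \<in> aut \<Longrightarrow> iota_m g \<in> (\<Pi>\<^sub>E z\<in>bmX. bmX :: 'a bm set)"
  unfolding iota_m_def using act_mem_bmX by (simp add: restrict_PiE_iff)

lemma j_d_mem: "j_d g \<in> (\<Pi>\<^sub>E x\<in>UNIV. bmX :: 'a bm set)"
  by (auto simp: j_d_def Pt_mem_bmX)

lemma coded_by_bm_power:
  "coded_by (product_topology (\<lambda>_. bmTop) I) (\<lambda>(i, y) f. code (f i) (y::'a))"
  using coded_by_product_topology[OF coded_by_bmTop] .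

lemma topspace_bm_power: "topspace (product_topology (\<lambda>_. bmTop) I) = (\<Pi>\<^sub>E i\<in>I. bmX :: 'a bm set)"
  by (simp add: topspace_bmTop)

lemma mem_eG_iff:
  "f \<in> eG \<longleftrightarrow> f \<in> (\<Pi>\<^sub>E z\<in>bmX. bmX) \<and>
     (\<forall>Z Y. finite Z \<longrightarrow> finite Y \<longrightarrow> Z \<subseteq> bmX \<longrightarrow>
        (\<exists>g\<in>aut. \<forall>z\<in>Z. \<forall>y\<in>Y. code (act g z) y = code (f z) (y::'a)))" (is "?L \<longleftrightarrow> ?M \<and> ?R")
proof -
  have sub: "iota_m ` aut \<subseteq> topspace (product_topology (\<lambda>_. bmTop) bmX :: ('a bm \<Rightarrow> 'a bm) topology)"
    unfolding topspace_bm_power using iota_m_mem by blast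
  have L: "?L \<longleftrightarrow> ?M \<and> (\<forall>F. finite F \<longrightarrow> (\<exists>s\<in>iota_m ` aut. \<forall>k\<in>F.
       (case k of (i, y) \<Rightarrow> \<lambda>f. code (f i) y) s = (case k of (i, y) \<Rightarrow> \<lambda>f. code (f i) y) f))"
    unfolding eG_def coded_by_in_closure_of[OF coded_by_bm_power sub] topspace_bm_power ..
  show ?thesis
  proof (intro iffI conjI allI impI)
    show "f \<in> (\<Pi>\<^sub>E z\<in>bmX. bmX)" if ?L using that L by blast
    fix Z :: "'a bm set" and Y :: "'a set" assume ?L and ZY: "finite Z" "finite Y" "Z \<subseteq> bmX"
    then have "\<exists>s\<in>iota_m ` aut. \<forall>k\<in>Z \<times> Y.
       (case k of (i, y) \<Rightarrow> \<lambda>f. code (f i) y) s = (case k of (i, y) \<Rightarrow> \<lambda>f. code (f i) y) f"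
      using L finite_cartesian_product[OF ZY(1,2)] by blast
    then obtain g where g: "g \<in> aut" "\<forall>k\<in>Z \<times> Y. (case k of (i, y) \<Rightarrow> \<lambda>f. code (f i) y) (iota_m g)
        = (case k of (i, y) \<Rightarrow> \<lambda>f. code (f i) y) f" by blast
    have "code (act g z) y = code (f z) y" if "z \<in> Z" "y \<in> Y" for z y
    proof -
      have "z \<in> bmX" using that ZY(3) by blast
      then show ?thesis using g(2)[THEN bspec, of "(z, y)"] that by (simp add: iota_m_def)
    qed
    then show "\<exists>g\<in>aut. \<forall>z\<in>Z. \<forall>y\<in>Y. code (act g z) y = code (f z) y" using g(1) by blast
  next
    assume MR: "?M \<and> ?R"
    have "\<exists>s\<in>iota_m ` aut. \<forall>k\<in>F.
       (case k of (i, y) \<Rightarrow> \<lambda>f. code (f i) y) s = (case k of (i, y) \<Rightarrow> \<lambda>f. code (f i) y) f"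
      if F: "finite F" for F
    proof -
      obtain g where g: "g \<in> aut" "\<forall>z\<in>fst ` F \<inter> bmX. \<forall>y\<in>snd ` F. code (act g z) y = code (f z) y"
        using conjunct2[OF MR, THEN spec, THEN spec, of "fst ` F \<inter> bmX" "snd ` F"] F by auto
      have "code (iota_m g z) y = code (f z) y" if "(z, y) \<in> F" for z y
      proof (cases "z \<in> bmX")
        case True
        have "z \<in> fst ` F" "y \<in> snd ` F" using that by force+
        then have "code (act g z) y = code (f z) y" using g(2) True by blast
        then show ?thesis using True by (simp add: iota_m_def)
      next
        case False
        have "f z = undefined" using PiE_arb[OF conjunct1[OF MR] False] .
        then show ?thesis using False by (simp add: iota_m_def)
      qed
      then show ?thesis using g(1) by (intro bexI[of _ "iota_m g"]) auto
    qed
    then show ?L using L MR by blast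
  qed
qed

text \<open>Each clause concerns at most three arguments and can be checked at one or two test
  points at a time. There the limit \<open>f\<close> agrees with an automorphism, for which the
  clause is evident.\<close>

lemma eG_subset_model: "eG \<subseteq> (ellis_model :: ('a bm \<Rightarrow> 'a bm) set)"
proof
  fix f :: "'a bm \<Rightarrow> 'a bm" assume f: "f \<in> eG"
  then have fX: "f \<in> (\<Pi>\<^sub>E z\<in>bmX. bmX)" unfolding mem_eG_iff by blast
  have fz: "f z \<in> bmX" if "z \<in> bmX" for z using fX that by (rule PiE_mem)
  have ap: "\<exists>g\<in>aut. \<forall>z\<in>Z. \<forall>y\<in>Y. code (act g z) y = code (f z) y"
    if "finite Z" "finite Y" "Z \<subseteq> bmX" for Z Y using f that unfolding mem_eG_iff by blast
  \<comment> \<open>A sign 0 at \<open>y\<close> pins the argument down to one point of X. This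
    carries information from values in X back to arguments.\<close>
  have zero: "z = Pt x 0" if "z \<in> bmX" "g \<in> aut" "code (act g z) y = 0" "x = inv g y" for z :: "'a bm" and g y x
    using that by (simp add: code_act code_0_iff)
  have mono: "bm_le (f z) (f w)" if zw: "z \<in> bmX" "w \<in> bmX" "bm_le z w" for z w
    unfolding bm_le_iff_code[OF fz[OF zw(1)] fz[OF zw(2)]]
  proof
    fix y
    obtain g where g: "g \<in> aut" "code (act g z) y = code (f z) y" "code (act g w) y = code (f w) y"
      using ap[of "{z, w}" "{y}"] zw(1,2) by auto
    have "code z (inv g y) \<le> code w (inv g y)" using zw bm_le_iff_code by blast
    then show "code (f z) y \<le> code (f w) y" using g code_act[OF g(1)] by simp
  qed
  have X0: "f z \<notin> X0" if z: "z \<in> bmX - X0" for z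
  proof
    assume "f z \<in> X0"
    then obtain y where y: "f z = Pt y 0" by (auto simp: X0_def)
    obtain g where "g \<in> aut" "code (act g z) y = code (f z) y" using ap[of "{z}" "{y}"] z by auto
    then have "z = Pt (inv g y) 0" using zero[of z g y] z y by simp
    then show False using z by (auto simp: X0_def)
  qed
  have inj: "f z \<in> bmX - X0" if zw: "z \<in> bmX" "w \<in> bmX" "f z = f w" "z \<noteq> w" for z w
  proof (rule ccontr)
    assume "f z \<notin> bmX - X0"
    then obtain y where y: "f z = Pt y 0" using fz[OF zw(1)] by (auto simp: X0_def)
    obtain g where "g \<in> aut" "code (act g z) y = code (f z) y" "code (act g w) y = code (f w) y"
      using ap[of "{z, w}" "{y}"] zw by auto
    moreover have "code (f z) y = 0" "code (f w) y = 0" unfolding zw(3)[symmetric] y by simp_all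
    ultimately have "z = Pt (inv g y) 0" "w = Pt (inv g y) 0"
      using zero[OF zw(1), of g y "inv g y"] zero[OF zw(2), of g y "inv g y"] by simp_all
    then show False using zw by simp
  qed
  have Ptm: "Pt x j \<in> bmX" if "j \<in> {-1, 0, 1}" for x :: 'a and j using that by (simp add: Pt_mem_bmX)
  have triple: "(f (Pt x (-1)) = f (Pt x 0) \<and> f (Pt x 0) = f (Pt x 1) \<and> f (Pt x 0) \<notin> X0)
             \<or> (\<exists>y. \<forall>j\<in>{-1, 0, 1}. f (Pt x j) = Pt y j)" for x
  proof (cases "f (Pt x 0) \<in> X0")
    case True
    then obtain y where y: "f (Pt x 0) = Pt y 0" by (auto simp: X0_def)
    have "f (Pt x j) = Pt y j" if j: "j \<in> {-1, 0, 1}" for j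
    proof (rule code_inject[OF fz[OF Ptm[OF j]] Ptm[OF j]])
      fix v
      \<comment> \<open>Testing at \<open>y\<close> in addition to \<open>v\<close> forces
        \<open>g x = y\<close>, because the code of \<open>f (Pt x 0)\<close> vanishes
        there.\<close>
      obtain g where g: "g \<in> aut" "code (act g (Pt x 0)) y = code (f (Pt x 0)) y"
          "code (act g (Pt x j)) v = code (f (Pt x j)) v"
        using ap[of "{Pt x 0, Pt x j}" "{y, v}"] Ptm[of 0 x] Ptm[OF j, of x] by auto
      then have "g x = y" using y by (auto split: if_splits)
      then show "code (f (Pt x j)) v = code (Pt y j) v" using g(3) by simp
    qed
    then show ?thesis by blast
  next
    case False
    have collapse: "f (Pt x j) = f (Pt x 0)" if j: "j \<in> {-1, 0, 1}" for j
    proof (rule code_inject[OF fz[OF Ptm[OF j]] fz[OF Ptm[of 0]]])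
      fix v
      obtain g where g: "g \<in> aut" "code (act g (Pt x 0)) v = code (f (Pt x 0)) v"
          "code (act g (Pt x j)) v = code (f (Pt x j)) v"
        using ap[of "{Pt x 0, Pt x j}" "{v}"] Ptm[of 0 x] Ptm[OF j, of x] by auto
      have "f (Pt x 0) \<noteq> Pt v 0" using False by (auto simp: X0_def)
      then have "code (f (Pt x 0)) v \<noteq> 0" using code_0_iff[OF fz[OF Ptm[of 0 x]], of v] by simp
      \<comment> \<open>Away from \<open>g x\<close> the three copies of \<open>g x\<close> have the
        same sign, so the three values of \<open>f\<close> cannot be told apart at
        \<open>v\<close>.\<close>
      then have "g x \<noteq> v" using g(2) by auto
      then show "code (f (Pt x j)) v = code (f (Pt x 0)) v" unfolding g(2,3)[symmetric] by auto
    qed simp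
    have "f (Pt x (-1)) = f (Pt x 0)" "f (Pt x 0) = f (Pt x 1)"
      using collapse[of "-1"] collapse[of 1, symmetric] by blast+
    then show ?thesis using False by blast
  qed
  have ends: "f (Cut A) = Cut A" if A: "A = {} \<or> A = UNIV" for A
  proof -
    have gap: "is_gap A" using A is_gap_empty is_gap_UNIV by blast
    then have AX: "Cut A \<in> bmX" by (simp add: Cut_mem_bmX)
    show ?thesis
    proof (rule code_inject[OF fz[OF AX] AX])
      fix v
      obtain g where g: "g \<in> aut" "code (act g (Cut A)) v = code (f (Cut A)) v"
        using ap[of "{Cut A}" "{v}"] AX by auto
      then show "code (f (Cut A)) v = code (Cut A) v" using A code_act[OF g(1), of "Cut A" v] by auto
    qed
  qed
  show "f \<in> ellis_model"
    unfolding ellis_model_def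
    using fX mono X0 inj triple ends[of "{}"] ends[of UNIV] by blast
qed

lemma model_subset_eG: "(ellis_model :: ('a bm \<Rightarrow> 'a bm) set) \<subseteq> eG"
proof
  fix f :: "'a bm \<Rightarrow> 'a bm" assume "f \<in> ellis_model"
  then have fX: "f \<in> (\<Pi>\<^sub>E z\<in>bmX. bmX)"
    and mono: "\<And>z w. z \<in> bmX \<Longrightarrow> w \<in> bmX \<Longrightarrow> bm_le z w \<Longrightarrow> bm_le (f z) (f w)"
    and X0: "\<And>z. z \<in> bmX - X0 \<Longrightarrow> f z \<notin> X0"
    and inj: "\<And>z w. z \<in> bmX \<Longrightarrow> w \<in> bmX \<Longrightarrow> f z = f w \<Longrightarrow> z \<noteq> w \<Longrightarrow> f z \<in> bmX - X0"
    and triple: "\<And>x. (f (Pt x (-1)) = f (Pt x 0) \<and> f (Pt x 0) = f (Pt x 1) \<and> f (Pt x 0) \<notin> X0)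
             \<or> (\<exists>y. \<forall>j\<in>{-1, 0, 1}. f (Pt x j) = Pt y j)"
    and ends: "f (Cut {}) = Cut {}" "f (Cut UNIV) = Cut UNIV"
    unfolding ellis_model_def by blast+
  have fz: "f z \<in> bmX" if "z \<in> bmX" for z using fX that by (rule PiE_mem)
  have "\<exists>g\<in>aut. \<forall>z\<in>Z. \<forall>y\<in>Y. code (act g z) y = code (f z) y"
    if Z: "finite Z" "finite Y" "Z \<subseteq> bmX" for Z Y
  proof -
    \<comment> \<open>\<open>interpolate\<close> works with points and gaps, so side copies are
      replaced by their base points; clause (iv) recovers them afterwards. The ends are added as the
      required bounds.\<close>
    let ?Z = "base ` Z \<union> {Cut {}, Cut UNIV}"
    have ZX: "?Z \<subseteq> bmX" "?Z \<subseteq> X0 \<union> range Cut"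
      using Z(3) base_mem is_gap_empty is_gap_UNIV by (auto simp: Cut_mem_bmX)
    have "\<exists>g\<in>aut. \<forall>y\<in>Y. \<forall>z\<in>?Z. code (act g z) y = code (f z) y"
    proof (rule interpolate[OF _ ZX _ _ _ _ _ _ ends Z(2)])
      show "f z \<in> bmX" if "z \<in> ?Z" for z using fz ZX(1) that by blast
      show "bm_le (f z) (f w)" if "z \<in> ?Z" "w \<in> ?Z" "bm_le z w" for z w
        using mono[of z w] ZX(1) that by blast
      show "z \<in> X0" if "z \<in> ?Z" "f z \<in> X0" for z using X0[of z] ZX(1) that by blast
      show "z = w" if "z \<in> ?Z" "w \<in> ?Z" "f z = f w" "f z \<in> X0" for z w
        using inj[of z w] ZX(1) that by blast
    qed (use Z(1) in auto)
    then obtain g where g: "g \<in> aut" "\<forall>y\<in>Y. \<forall>z\<in>?Z. code (act g z) y = code (f z) y" by blast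
    have "code (act g z) y = code (f z) y" if "z \<in> Z" "y \<in> Y" for z y
    proof (cases z)
      case (Cut A)
      then have "z \<in> ?Z" using that by force
      then show ?thesis using g(2) that by blast
    next
      case (Pt x j)
      then have j: "j \<in> {-1, 0, 1}" using that Z(3) by (auto simp: Pt_mem_bmX)
      have "Pt x 0 \<in> ?Z" using that Pt by force
      then have "code (act g (Pt x 0)) y = code (f (Pt x 0)) y" using g(2) that by blast
      then have eq: "code (Pt (g x) 0) y = code (f (Pt x 0)) y" by (simp only: act.simps)
      from triple[of x] show ?thesis
      proof
        assume A: "f (Pt x (-1)) = f (Pt x 0) \<and> f (Pt x 0) = f (Pt x 1) \<and> f (Pt x 0) \<notin> X0"
        then have fj: "f z = f (Pt x 0)" using j Pt by auto
        \<comment> \<open>In the collapsed case the common value is outside X, so its sign at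
          \<open>y\<close> is not 0. Hence \<open>g x\<close> differs from \<open>y\<close>, and all
          copies of \<open>g x\<close> have the sign found for the middle one.\<close>
        have "f (Pt x 0) \<noteq> Pt y 0" using A by (auto simp: X0_def)
        then have "code (f (Pt x 0)) y \<noteq> 0"
          using code_0_iff[OF fz, of "Pt x 0" y] by (simp add: Pt_mem_bmX)
        then have "g x \<noteq> y" using eq by auto
        then show ?thesis using eq Pt fj by auto
      next
        assume "\<exists>y. \<forall>j\<in>{-1, 0, 1}. f (Pt x j) = Pt y j"
        then obtain v where v: "\<forall>j\<in>{-1, 0, 1}. f (Pt x j) = Pt v j" by blast
        then have "f (Pt x 0) = Pt v 0" "f z = Pt v j" using j Pt by blast+
        then show ?thesis using eq Pt by (auto split: if_splits)
      qed
    qed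
    then show ?thesis using g(1) by blast
  qed
  then show "f \<in> eG" unfolding mem_eG_iff using fX by blast
qed

lemma eG_eq_model: "(eG :: ('a bm \<Rightarrow> 'a bm) set) = ellis_model"
  using eG_subset_model model_subset_eG by blast

lemma brModel_eq_closure:
  "(product_topology (\<lambda>_. bmTop) UNIV) closure_of (j_d ` aut) = (brModel :: ('a \<Rightarrow> 'a bm) set)"
proof -
  have sub: "j_d ` aut \<subseteq> topspace (product_topology (\<lambda>_. bmTop) UNIV :: ('a \<Rightarrow> 'a bm) topology)"
    unfolding topspace_bm_power using j_d_mem by blast
  note cl = coded_by_in_closure_of[OF coded_by_bm_power sub, unfolded topspace_bm_power]
  show ?thesis
  proof (intro equalityI subsetI)
    fix f :: "'a \<Rightarrow> 'a bm" assume f: "f \<in> (product_topology (\<lambda>_. bmTop) UNIV) closure_of (j_d ` aut)"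
    then have fX: "f \<in> (\<Pi>\<^sub>E x\<in>UNIV. bmX)" unfolding cl by blast
    have fz: "f x \<in> bmX" for x using fX by (rule PiE_mem) simp
    have ap: "\<exists>g\<in>aut. code (Pt (g x) 0) v = code (f x) v \<and> code (Pt (g y) 0) v = code (f y) v" for x y v
    proof -
      have "finite {(x, v), (y, v)}" by simp
      then obtain s where "s \<in> j_d ` aut" "\<forall>k\<in>{(x, v), (y, v)}.
         (case k of (i, y) \<Rightarrow> \<lambda>f. code (f i) y) s = (case k of (i, y) \<Rightarrow> \<lambda>f. code (f i) y) f"
        using f unfolding cl by blast
      then show ?thesis by (auto simp: j_d_def simp del: code.simps)
    qed
    have "bm_le (f x) (f y)" if "x \<le> y" for x y
      unfolding bm_le_iff_code[OF fz fz]
    proof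
      fix v
      obtain g where g: "g \<in> aut" "code (Pt (g x) 0) v = code (f x) v" "code (Pt (g y) 0) v = code (f y) v"
        using ap by blast
      have "g x = g y \<or> g x < g y" using that aut_less_iff[OF g(1), of x y] by (auto simp: le_less)
      then show "code (f x) v \<le> code (f y) v" unfolding g(2,3)[symmetric] by auto
    qed
    moreover have "f x \<notin> X0" if "x \<noteq> y" "f x = f y" for x y
    proof
      assume "f x \<in> X0"
      then obtain v where v: "f x = Pt v 0" by (auto simp: X0_def)
      obtain g where g: "g \<in> aut" "code (Pt (g x) 0) v = code (f x) v" "code (Pt (g y) 0) v = code (f y) v"
        using ap by blast
      then have "g x = v" "g y = v" using v that(2) by (auto split: if_splits)
      then show False using aut_eq_iff[OF g(1), of x y] that(1) by simp
    qed
    ultimately show "f \<in> brModel" unfolding brModel_def using fX by blast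
  next
    fix f :: "'a \<Rightarrow> 'a bm" assume "f \<in> brModel"
    note fb = CollectD[OF this[unfolded brModel_def]]
    note fX = conjunct1[OF fb]
    note mono = conjunct1[OF conjunct2[OF fb], rule_format]
    note inj = conjunct2[OF conjunct2[OF fb], rule_format, OF conjI]
    have fz: "f x \<in> bmX" for x using fX by (rule PiE_mem) simp
    \<comment> \<open>\<open>interpolate\<close> needs the ends as bounds, so \<open>f\<close> is
      extended by fixing them. It is applied to points of X and the two ends only; no condition is
      imposed at proper gaps.\<close>
    define f' where "f' z = (case z of Pt x j \<Rightarrow> f x | Cut A \<Rightarrow> Cut A)" for z
    have "\<exists>s\<in>j_d ` aut. \<forall>k\<in>F.
         (case k of (i, y) \<Rightarrow> \<lambda>f. code (f i) y) s = (case k of (i, y) \<Rightarrow> \<lambda>f. code (f i) y) f"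
      if F: "finite F" for F
    proof -
      let ?Z = "pts (fst ` F) \<union> {Cut {}, Cut UNIV}"
      have ZX: "?Z \<subseteq> bmX" "?Z \<subseteq> X0 \<union> range Cut"
        using pts_subset[of "fst ` F"] is_gap_empty is_gap_UNIV by (auto simp: Cut_mem_bmX)
      have ZE: "(\<exists>x. z = Pt x 0) \<or> z = Cut {} \<or> z = Cut UNIV" if "z \<in> ?Z" for z
        using that unfolding pts_def by blast
      have f'X: "f' z \<in> bmX" if "z \<in> ?Z" for z
        using ZE[OF that] ZX(1) that fz unfolding f'_def by auto
      have "\<exists>g\<in>aut. \<forall>y\<in>snd ` F. \<forall>z\<in>?Z. code (act g z) y = code (f' z) y"
      proof (rule interpolate[OF _ ZX])
        show "bm_le (f' z) (f' w)" if zw: "z \<in> ?Z" "w \<in> ?Z" "bm_le z w" for z w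
        proof -
          have bot: "bm_le (Cut {}) a" and top: "bm_le a (Cut UNIV)" if "a \<in> bmX" for a :: "'a bm"
            using that by (cases a; auto simp: bm_le_def)+
          consider x y where "z = Pt x 0" "w = Pt y 0" | "z = Cut {}" | "w = Cut UNIV"
            | x where "z = Pt x 0" "w = Cut {}" | y where "z = Cut UNIV" "w = Pt y 0" | "z = Cut UNIV" "w = Cut {}"
            using ZE[OF zw(1)] ZE[OF zw(2)] by blast
          then show ?thesis
          proof cases
            case 1
            then have "x \<le> y" using zw(3) by (auto simp: bm_le_def)
            then show ?thesis using 1 mono unfolding f'_def by simp
          next
            case 2
            then have "f' z = Cut {}" unfolding f'_def by simp
            then show ?thesis using bot[OF f'X[OF zw(2)]] by simp
          next
            case 3
            then have "f' w = Cut UNIV" unfolding f'_def by simp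
            then show ?thesis using top[OF f'X[OF zw(1)]] by simp
          qed (use zw(3) in \<open>auto simp: bm_le_def\<close>)
        qed
        show "z \<in> X0" if "z \<in> ?Z" "f' z \<in> X0" for z
          using ZE[OF that(1)] that(2) unfolding f'_def by (auto simp: X0_def)
        show "z = w" if zw: "z \<in> ?Z" "w \<in> ?Z" "f' z = f' w" "f' z \<in> X0" for z w
        proof -
          have "\<exists>x. z = Pt x 0" using ZE[OF zw(1)] zw(4) unfolding f'_def by (auto simp: X0_def)
          moreover have "\<exists>x. w = Pt x 0" using ZE[OF zw(2)] zw(3,4) unfolding f'_def by (auto simp: X0_def)
          ultimately obtain x y where xy: "z = Pt x 0" "w = Pt y 0" by blast
          then show ?thesis using inj[of x y] zw(3,4) unfolding f'_def by auto
        qed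
      qed (use F finite_pts f'X in \<open>auto simp: f'_def\<close>)
      then obtain g where g: "g \<in> aut" "\<forall>y\<in>snd ` F. \<forall>z\<in>?Z. code (act g z) y = code (f' z) y" by blast
      have "code (j_d g x) y = code (f x) y" if "(x, y) \<in> F" for x y
      proof -
        have "Pt x 0 \<in> ?Z" "y \<in> snd ` F" using that unfolding pts_def by force+
        then have "code (act g (Pt x 0)) y = code (f' (Pt x 0)) y" using g(2) by blast
        then show ?thesis unfolding f'_def j_d_def by simp
      qed
      then show ?thesis using g(1) by (intro bexI[of _ "j_d g"]) auto
    qed
    then show "f \<in> (product_topology (\<lambda>_. bmTop) UNIV) closure_of (j_d ` aut)"
      unfolding cl using fX by blast
  qed
qed

end

lemma subtopology_closure_of_dense:
  assumes "compact_space P" "Hausdorff_space P" "S \<subseteq> topspace P"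
  shows "compact_space (subtopology P (P closure_of S))" "Hausdorff_space (subtopology P (P closure_of S))"
    "topspace (subtopology P (P closure_of S)) = P closure_of S"
    "subtopology P (P closure_of S) closure_of S = P closure_of S"
proof -
  show "compact_space (subtopology P (P closure_of S))"
    using assms(1) by (simp add: closedin_compact_space compact_space_subtopology)
  show "Hausdorff_space (subtopology P (P closure_of S))"
    using assms(2) by (rule Hausdorff_space_subtopology)
  show "topspace (subtopology P (P closure_of S)) = P closure_of S"
    using closure_of_subset_topspace[of P S] by auto
  have "P closure_of S \<inter> S = S" using closure_of_subset[OF assms(3)] by blast
  then show "subtopology P (P closure_of S) closure_of S = P closure_of S"
    by (simp add: closure_of_subtopology)
qed

section \<open>Both closures as completions, and the enveloping semigroup of the Roelcke
  completion\<close>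

context homogeneous_chain
begin

lemma compact_Hausdorff_bm_power:
  "compact_space (product_topology (\<lambda>_. bmTop :: 'a bm topology) I)"
  "Hausdorff_space (product_topology (\<lambda>_. bmTop :: 'a bm topology) I)"
  using compact_space_bmTop Hausdorff_space_bmTop
  by (simp_all add: compact_space_product_topology Hausdorff_space_product_topology)

lemma iota_m_subset: "iota_m ` aut \<subseteq> topspace (product_topology (\<lambda>_. bmTop :: 'a bm topology) bmX)"
  unfolding topspace_bm_power using iota_m_mem by blast

lemma j_d_subset: "j_d ` aut \<subseteq> topspace (product_topology (\<lambda>_. bmTop :: 'a bm topology) UNIV)"
  unfolding topspace_bm_power using j_d_mem by blast

lemmas eGtop_facts = subtopology_closure_of_dense[OF compact_Hausdorff_bm_power iota_m_subset,
    folded eG_def, folded eGtop_def]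

lemmas brTop_facts = subtopology_closure_of_dense[OF compact_Hausdorff_bm_power j_d_subset,
    unfolded brModel_eq_closure, folded brTop_def]

lemma coded_by_eGtop: "coded_by eGtop (\<lambda>(z, y) f. code (f z) (y::'a))"
  unfolding eGtop_def by (rule coded_by_subtopology[OF coded_by_bm_power])

lemma coded_by_brTop: "coded_by brTop (\<lambda>(x, y) f. code (f x) (y::'a))"
  unfolding brTop_def by (rule coded_by_subtopology[OF coded_by_bm_power])

lemma iota_m_mem_eG: "g \<in> aut \<Longrightarrow> iota_m g \<in> (eG :: ('a bm \<Rightarrow> 'a bm) set)"
  unfolding eG_def using closure_of_subset[OF iota_m_subset] by blast

lemma j_d_mem_brModel: "g \<in> aut \<Longrightarrow> j_d g \<in> (brModel :: ('a \<Rightarrow> 'a bm) set)"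
  using closure_of_subset[OF j_d_subset] unfolding brModel_eq_closure by blast

lemma iota_m_Pt: "iota_m g (Pt (x::'a) 0) = Pt (g x) 0"
  by (simp add: iota_m_def Pt_mem_bmX)

lemma eGtop_completion: "is_compact_completion eGtop iota_m (aut :: ('a \<Rightarrow> 'a) set) R_Sigma_bm"
proof (rule coded_by_compact_completionI[OF coded_by_eGtop eGtop_facts(1,2)])
  show "iota_m ` aut \<subseteq> topspace (eGtop :: ('a bm \<Rightarrow> 'a bm) topology)"
    unfolding eGtop_facts(3) using iota_m_mem_eG by blast
  show "inj_on iota_m (aut :: ('a \<Rightarrow> 'a) set)"
  proof (rule inj_onI, rule ext)
    fix g h :: "'a \<Rightarrow> 'a" and x assume "iota_m g = iota_m h"
    then have "iota_m g (Pt x 0) = iota_m h (Pt x 0)" by simp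
    then show "g x = h x" by (simp add: iota_m_Pt)
  qed
  show "eGtop closure_of iota_m ` aut = topspace (eGtop :: ('a bm \<Rightarrow> 'a bm) topology)"
    unfolding eGtop_facts(3,4) ..
  show "R_Sigma_bm = code_unif aut (\<lambda>k g. (case k of (z, y) \<Rightarrow> \<lambda>f. code (f z) (y::'a)) (iota_m g))"
    unfolding R_Sigma_bm_coded by (rule arg_cong[where f = "code_unif aut"]) (auto simp: fun_eq_iff)
qed

lemma brTop_completion: "is_compact_completion brTop j_d (aut :: ('a \<Rightarrow> 'a) set) roelcke"
proof (rule coded_by_compact_completionI[OF coded_by_brTop brTop_facts(1,2)])
  show "j_d ` aut \<subseteq> topspace (brTop :: ('a \<Rightarrow> 'a bm) topology)"
    unfolding brTop_facts(3) using j_d_mem_brModel by blast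
  show "inj_on j_d (aut :: ('a \<Rightarrow> 'a) set)"
    by (rule inj_onI) (auto simp: j_d_def fun_eq_iff)
  show "brTop closure_of j_d ` aut = topspace (brTop :: ('a \<Rightarrow> 'a bm) topology)"
    unfolding brTop_facts(3,4) ..
  show "roelcke = code_unif aut (\<lambda>k g. (case k of (x, y) \<Rightarrow> \<lambda>f. code (f x) (y::'a)) (j_d g))"
    unfolding roelcke_coded by (rule arg_cong[where f = "code_unif aut"]) (auto simp: fun_eq_iff)
qed

text \<open>Hence \<open>eG\<close> acts on \<open>brModel\<close> by composition. For distinct
  points with the same image, a coincidence already present in \<open>b\<close> has its value
  outside X, and clause (ii) for \<open>f\<close> keeps it there; a coincidence created by
  \<open>f\<close> is covered by clause (iii).\<close>

lemma comp_mem_brModel: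
  fixes f :: "'a bm \<Rightarrow> 'a bm"
  assumes "f \<in> eG" "b \<in> brModel"
  shows "f \<circ> b \<in> brModel"
proof -
  note b = CollectD[OF assms(2)[unfolded brModel_def]]
  note bmono = conjunct1[OF conjunct2[OF b], rule_format]
  note binj = conjunct2[OF conjunct2[OF b], rule_format, OF conjI]
  have bX: "b x \<in> bmX" for x using conjunct1[OF b] by (rule PiE_mem) simp
  have "f \<in> ellis_model" using assms(1) unfolding eG_eq_model .
  then have fX: "f \<in> (\<Pi>\<^sub>E z\<in>bmX. bmX)"
    and mono: "\<And>z w. z \<in> bmX \<Longrightarrow> w \<in> bmX \<Longrightarrow> bm_le z w \<Longrightarrow> bm_le (f z) (f w)"
    and X0: "\<And>z. z \<in> bmX - X0 \<Longrightarrow> f z \<notin> X0"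
    and inj: "\<And>z w. z \<in> bmX \<Longrightarrow> w \<in> bmX \<Longrightarrow> f z = f w \<Longrightarrow> z \<noteq> w \<Longrightarrow> f z \<in> bmX - X0"
    unfolding ellis_model_def by blast+
  have "f (b x) \<in> bmX" for x using fX bX by (rule PiE_mem)
  then have mem: "f \<circ> b \<in> (\<Pi>\<^sub>E x\<in>UNIV. bmX)" by auto
  have le: "bm_le ((f \<circ> b) x) ((f \<circ> b) y)" if "x \<le> y" for x y
    using mono[OF bX bX bmono[OF that]] by simp
  have ninj: "(f \<circ> b) x \<notin> X0" if "x \<noteq> y" "(f \<circ> b) x = (f \<circ> b) y" for x y
  proof (cases "b x = b y")
    case True
    then have "b x \<in> bmX - X0" using binj[OF that(1)] bX by blast
    then show ?thesis using X0 by simp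
  next
    case False
    then show ?thesis using inj[OF bX bX _ False] that(2) by simp
  qed
  show ?thesis
    unfolding brModel_def
  proof (intro CollectI conjI allI impI)
    show "(f \<circ> b) x \<notin> X0" if "x \<noteq> y \<and> (f \<circ> b) x = (f \<circ> b) y" for x y
      using ninj[of x y] that by blast
  qed (fact mem, fact le)
qed

lemma continuous_map_comp_left:
  fixes b :: "'a \<Rightarrow> 'a bm"
  assumes "b \<in> brModel"
  shows "continuous_map eGtop brTop (\<lambda>f. f \<circ> b)"
proof (rule coded_by_continuous_map[OF coded_by_eGtop coded_by_brTop])
  show "(\<lambda>f. f \<circ> b) ` topspace eGtop \<subseteq> topspace brTop"
    unfolding eGtop_facts(3) brTop_facts(3) using comp_mem_brModel[OF _ assms] by blast
  fix k :: "'a \<times> 'a"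
  obtain x y where k: "k = (x, y)" by force
  show "\<exists>F. finite F \<and> (\<forall>f\<in>topspace eGtop. \<forall>f'\<in>topspace eGtop.
      (\<forall>i\<in>F. (case i of (z, y) \<Rightarrow> \<lambda>f. code (f z) y) f = (case i of (z, y) \<Rightarrow> \<lambda>f. code (f z) y) f') \<longrightarrow>
      (case k of (x, y) \<Rightarrow> \<lambda>f. code (f x) y) (f \<circ> b) = (case k of (x, y) \<Rightarrow> \<lambda>f. code (f x) y) (f' \<circ> b))"
    unfolding k by (rule exI[of _ "{(b x, y)}"]) simp
qed

lemma continuous_map_comp_iota:
  assumes "g \<in> aut"
  shows "continuous_map brTop brTop (\<lambda>b :: 'a \<Rightarrow> 'a bm. iota_m g \<circ> b)"
proof (rule coded_by_continuous_map[OF coded_by_brTop coded_by_brTop])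
  show "(\<lambda>b. iota_m g \<circ> b) ` topspace brTop \<subseteq> topspace (brTop :: ('a \<Rightarrow> 'a bm) topology)"
    unfolding brTop_facts(3) using comp_mem_brModel[OF iota_m_mem_eG[OF assms]] by blast
  fix k :: "'a \<times> 'a"
  obtain x y where k: "k = (x, y)" by force
  have "code (iota_m g (b x)) y = code (b x) (inv g y)" if "b \<in> brModel" for b
  proof -
    have "b \<in> (\<Pi>\<^sub>E x\<in>UNIV. bmX)" using CollectD[OF that[unfolded brModel_def]] by (rule conjunct1)
    then have "b x \<in> bmX" by (rule PiE_mem) simp
    then show ?thesis using code_act[OF assms] by (simp add: iota_m_def)
  qed
  then show "\<exists>F. finite F \<and> (\<forall>b\<in>topspace brTop. \<forall>b'\<in>topspace brTop.
      (\<forall>i\<in>F. (case i of (x, y) \<Rightarrow> \<lambda>f. code (f x) y) b = (case i of (x, y) \<Rightarrow> \<lambda>f. code (f x) y) b') \<longrightarrow>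
      (case k of (x, y) \<Rightarrow> \<lambda>f. code (f x) y) (iota_m g \<circ> b) = (case k of (x, y) \<Rightarrow> \<lambda>f. code (f x) y) (iota_m g \<circ> b'))"
    unfolding k brTop_facts(3) by (intro exI[of _ "{(x, inv g y)}"]) simp
qed

lemma iota_m_comp_j_d: "iota_m g \<circ> j_d k = (j_d (g \<circ> k) :: 'a \<Rightarrow> 'a bm)"
  by (auto simp: fun_eq_iff j_d_def iota_m_Pt)

text \<open>The identity takes every value in X. For \<open>z\<close> outside X the constant map
  with value \<open>z\<close> qualifies, since \<open>brModel\<close> allows coincidences at such
  values. This makes the action of \<open>eG\<close> on \<open>brModel\<close> faithful.\<close>

lemma ex_brModel_value:
  assumes "z \<in> bmX"
  shows "\<exists>b \<in> brModel. \<exists>x::'a. b x = z"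
proof (cases "z \<in> X0")
  case True
  then obtain x where x: "z = Pt x 0" by (auto simp: X0_def)
  show ?thesis using j_d_mem_brModel[OF aut_id] x by (intro bexI[of _ "j_d id"] exI[of _ x]) (simp_all add: j_d_def)
next
  case False
  have "(\<lambda>_. z) \<in> (brModel :: ('a \<Rightarrow> 'a bm) set)"
    unfolding brModel_def
  proof (intro CollectI conjI allI impI)
    show "(\<lambda>_. z) \<in> (\<Pi>\<^sub>E x\<in>UNIV. bmX)" by (rule PiE_I) (simp_all add: assms)
  qed (simp_all add: bm_le_def False)
  then show ?thesis by (rule bexI[rotated]) simp
qed

lemma Roelcke_completion_le:
  assumes T: "is_compact_completion (T :: 'k topology) j (aut :: ('a \<Rightarrow> 'a) set) roelcke"
  shows "comp_le T j eGtop iota_m"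
proof -
  obtain \<psi> where \<psi>: "continuous_map brTop T \<psi>" "\<And>g. g \<in> aut \<Longrightarrow> \<psi> (j_d g) = j g"
    using compact_completion_extend_completion[OF brTop_completion T] by blast
  \<comment> \<open>As \<open>j_d id\<close> is the inclusion of X into \<open>bmX\<close>,
    composing with it restricts \<open>f\<close> to X; \<open>\<psi>\<close> then passes from the
    concrete model to an arbitrary completion \<open>T\<close>.\<close>
  have "continuous_map eGtop T (\<psi> \<circ> (\<lambda>f. f \<circ> j_d id))"
    by (rule continuous_map_compose[OF continuous_map_comp_left[OF j_d_mem_brModel[OF aut_id]] \<psi>(1)])
  then show ?thesis unfolding comp_le_def
    by (intro exI[of _ "\<psi> \<circ> (\<lambda>f. f \<circ> j_d id)"] conjI ballI) (simp_all add: iota_m_comp_j_d \<psi>(2))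
qed

lemma Ellis_Roelcke_completion_iso:
  assumes T: "is_compact_completion (T :: 'k topology) j (aut :: ('a \<Rightarrow> 'a) set) roelcke"
  shows "comp_iso eGtop iota_m (ellis_top T j) (iota_K T j)"
proof -
  obtain \<phi> \<psi> where \<phi>: "continuous_map T brTop \<phi>" and \<psi>: "continuous_map brTop T \<psi>"
    and \<phi>j: "\<And>g. g \<in> aut \<Longrightarrow> \<phi> (j g) = j_d g" and \<psi>j: "\<And>g. g \<in> aut \<Longrightarrow> \<psi> (j_d g) = j g"
    and \<psi>\<phi>: "\<And>t. t \<in> topspace T \<Longrightarrow> \<psi> (\<phi> t) = t" and \<phi>\<psi>: "\<And>b. b \<in> topspace brTop \<Longrightarrow> \<phi> (\<psi> b) = b"
    using compact_completion_unique[OF T brTop_completion] by blast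
  have HT: "Hausdorff_space T" and jT: "j ` aut \<subseteq> topspace T"
    using T by (auto simp: is_compact_completion_def)
  have \<phi>m: "\<phi> t \<in> brModel" if "t \<in> topspace T" for t
    using continuous_map_image_subset_topspace[OF \<phi>] that unfolding brTop_facts(3) by blast
  have \<psi>m: "\<psi> b \<in> topspace T" if "b \<in> brModel" for b
    using continuous_map_image_subset_topspace[OF \<psi>] that unfolding brTop_facts(3) by blast
  let ?P = "product_topology (\<lambda>_. T) (topspace T)"
  have HP: "Hausdorff_space ?P" using HT by (simp add: Hausdorff_space_product_topology)
  \<comment> \<open>The action of \<open>f\<close> on \<open>brModel\<close>, conjugated to
    \<open>T\<close> by the mutually inverse maps \<open>\<phi>\<close> and
    \<open>\<psi>\<close>.\<close>
  define p where "p f = restrict (\<lambda>t. \<psi> (f \<circ> \<phi> t)) (topspace T)" for f :: "'a bm \<Rightarrow> 'a bm"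
  have p_cont: "continuous_map eGtop ?P p"
    unfolding continuous_map_componentwise
  proof (intro conjI ballI)
    show "p ` topspace eGtop \<subseteq> extensional (topspace T)" unfolding p_def by auto
    fix t assume t: "t \<in> topspace T"
    have "continuous_map eGtop T (\<psi> \<circ> (\<lambda>f. f \<circ> \<phi> t))"
      by (rule continuous_map_compose[OF continuous_map_comp_left[OF \<phi>m[OF t]] \<psi>])
    then show "continuous_map eGtop T (\<lambda>f. p f t)" unfolding p_def using t by (simp add: o_def)
  qed
  have p_iota: "p (iota_m g) = iota_K T j g" if g: "g \<in> aut" for g
  proof -
    let ?h = "\<psi> \<circ> ((\<lambda>b. iota_m g \<circ> b) \<circ> \<phi>)"
    have h: "continuous_map T T ?h"
      by (rule continuous_map_compose[OF continuous_map_compose[OF \<phi> continuous_map_comp_iota[OF g]] \<psi>])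
    have hj: "?h (j k) = j (g \<circ> k)" if k: "k \<in> aut" for k
      using \<phi>j[OF k] \<psi>j[OF aut_comp[OF g k]] by (simp add: iota_m_comp_j_d)
    have "\<exists>h. continuous_map T T h \<and> (\<forall>k\<in>aut. h (j k) = j (g \<circ> k))"
      by (rule exI[of _ ?h]) (use h hj in blast)
    then have e: "continuous_map T T (ext_act T j g)" "\<forall>k\<in>aut. ext_act T j g (j k) = j (g \<circ> k)"
      unfolding ext_act_def using someI_ex[of "\<lambda>h. continuous_map T T h \<and> (\<forall>k\<in>aut. h (j k) = j (g \<circ> k))"]
      by simp_all
    \<comment> \<open>\<open>ext_act\<close> is an arbitrary choice of a continuous extension, but
      on \<open>T\<close> it is determined by its values on the dense image of the group.\<close>
    have "?h t = ext_act T j g t" if "t \<in> topspace T" for t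
      by (rule compact_completion_unique_maps[OF T HT h e(1) _ that]) (use hj e(2) in simp)
    then show ?thesis unfolding p_def iota_K_def by (intro restrict_ext) simp
  qed
  have p_inj: "inj_on p eG"
  proof (rule inj_onI)
    fix f f' assume ff: "f \<in> eG" "f' \<in> eG" "p f = p f'"
    have eq: "f \<circ> b = f' \<circ> b" if b: "b \<in> brModel" for b
    proof -
      have "p f (\<psi> b) = p f' (\<psi> b)" using ff(3) by simp
      then have "\<psi> (f \<circ> b) = \<psi> (f' \<circ> b)"
        unfolding p_def using \<psi>m[OF b] \<phi>\<psi>[of b] b brTop_facts(3) by simp
      then have "\<phi> (\<psi> (f \<circ> b)) = \<phi> (\<psi> (f' \<circ> b))" by simp
      then show ?thesis
        using \<phi>\<psi>[of "f \<circ> b"] \<phi>\<psi>[of "f' \<circ> b"] comp_mem_brModel[OF ff(1) b] comp_mem_brModel[OF ff(2) b]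
        by (simp add: brTop_facts(3))
    qed
    have "f z = f' z" if z: "z \<in> bmX" for z
    proof -
      obtain b x where "b \<in> brModel" "b x = z" using ex_brModel_value[OF z] by blast
      then show ?thesis using fun_cong[OF eq, of b x] by simp
    qed
    then show "f = f'"
      by (rule PiE_ext[OF conjunct1[OF ff(1)[unfolded mem_eG_iff]] conjunct1[OF ff(2)[unfolded mem_eG_iff]]])
  qed
  have "p ` eG = ?P closure_of (iota_K T j ` aut)"
  proof
    have im: "p ` (iota_m ` aut) = iota_K T j ` aut" using p_iota by force
    have "p ` (eGtop closure_of (iota_m ` aut)) \<subseteq> ?P closure_of (p ` (iota_m ` aut))"
      by (rule continuous_map_image_closure_subset[OF p_cont])
    then show "p ` eG \<subseteq> ?P closure_of (iota_K T j ` aut)" unfolding im eGtop_facts(4) .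
    \<comment> \<open>A continuous image of a compact space in a Hausdorff space is closed.
      Containing the image of the group, it contains its closure.\<close>
    have "closedin ?P (p ` topspace eGtop)"
      using continuous_imp_closed_map[OF p_cont eGtop_facts(1) HP] closed_map_def by blast
    then have "closedin ?P (p ` eG)" unfolding eGtop_facts(3) .
    moreover have "iota_K T j ` aut \<subseteq> p ` eG" unfolding im[symmetric] using iota_m_mem_eG by blast
    ultimately show "?P closure_of (iota_K T j ` aut) \<subseteq> p ` eG" by (simp add: closure_of_minimal)
  qed
  then have top: "p ` topspace eGtop = topspace (ellis_top T j)" "p ` topspace eGtop = ?P closure_of (iota_K T j ` aut)"
    unfolding eGtop_facts(3) ellis_top_def using closure_of_subset_topspace[of ?P "iota_K T j ` aut"] by auto
  have "homeomorphic_map eGtop (ellis_top T j) p"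
  proof (rule continuous_imp_homeomorphic_map)
    show "continuous_map eGtop (ellis_top T j) p"
      unfolding ellis_top_def by (rule continuous_map_into_subtopology[OF p_cont]) (use top(2) in auto)
    show "Hausdorff_space (ellis_top T j)"
      unfolding ellis_top_def using HP by (rule Hausdorff_space_subtopology)
  qed (use eGtop_facts top p_inj in auto)
  then show ?thesis unfolding comp_iso_def using p_iota by blast
qed

end

theorem mainTheorem16:
  assumes "infinite (UNIV :: 'a::linorder set)"
    and "ultrahomogeneous TYPE('a)"
  shows
    \<comment> \<open>(a)\<close>
    "is_compact_completion eGtop iota_m (aut :: ('a \<Rightarrow> 'a) set) R_Sigma_bm
     \<comment> \<open>(b)\<close>
     \<and> roelcke_precompact TYPE('a)
     \<and> (\<forall>(T :: 'k topology) (j :: ('a \<Rightarrow> 'a) \<Rightarrow> 'k).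
          is_compact_completion T j (aut :: ('a \<Rightarrow> 'a) set) roelcke \<longrightarrow>
            comp_le T j eGtop iota_m \<and> comp_iso eGtop iota_m (ellis_top T j) (iota_K T j))
     \<comment> \<open>(c)\<close>
     \<and> (eG :: ('a bm \<Rightarrow> 'a bm) set) =
        {f \<in> (\<Pi>\<^sub>E z\<in>bmX. bmX).
           (\<forall>x\<in>bmX. \<forall>y\<in>bmX. bm_le x y \<longrightarrow> bm_le (f x) (f y))
         \<and> (\<forall>x\<in>bmX - X0. f x \<notin> X0)
         \<and> (\<forall>x\<in>bmX. \<forall>y\<in>bmX. f x = f y \<and> x \<noteq> y \<longrightarrow> f x \<in> bmX - X0)
         \<and> (\<forall>x::'a. (f (Pt x (-1)) = f (Pt x 0) \<and> f (Pt x 0) = f (Pt x 1) \<and> f (Pt x 0) \<notin> X0)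
                   \<or> (\<exists>y. \<forall>j\<in>{-1, 0, 1}. f (Pt x j) = Pt y j))
         \<and> f (Cut {}) = Cut {} \<and> f (Cut UNIV) = Cut UNIV}
     \<comment> \<open>(d)\<close>
     \<and> is_compact_completion brTop j_d (aut :: ('a \<Rightarrow> 'a) set) roelcke
     \<comment> \<open>continuously ordered case\<close>
     \<and> (continuously_ordered TYPE('a) \<longrightarrow>
          is_compact_completion eGtop iota_m (aut :: ('a \<Rightarrow> 'a) set) roelcke)"
proof -
  interpret homogeneous_chain "TYPE('a)"
    by unfold_locales (fact assms)+
  have "is_compact_completion eGtop iota_m (aut :: ('a \<Rightarrow> 'a) set) roelcke"
    if "continuously_ordered TYPE('a)"
    using eGtop_completion continuously_ordered_R_Sigma_eq_roelcke[OF that] by simp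
  then show ?thesis
    by (intro conjI allI impI eGtop_completion Roelcke_precompact Roelcke_completion_le
        Ellis_Roelcke_completion_iso brTop_completion eG_eq_model[unfolded ellis_model_def])
qed

end
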